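(* Let $(\mathbf{C},\mathcal{M})$ be an $\mathcal{M}$-adhesive category with initial object $I$, satisfying the horizontal VK property and having effective pushouts. Let $TG_B\xleftarrow{tg_{DB}}TG_D\xrightarrow{tg_{DC}}TG_C$, $TG_B\xrightarrow{tg_{BA}}TG_A\xleftarrow{tg_{CA}}TG_C$ be a pushout square with all morphisms in $\mathcal{M}$, let $g_A=g_B+_{g_D}g_C$ be an amalgamation of typed objects $g_X:G_X\to TG_X$, and let $ac_A=ac_B+_{ac_D}ac_C$ be an amalgamation of positive constraints $ac_X$ over $I$ typed over $TG_X$ ($X\in\{A,B,C,D\}$). (Decomposition) If $Q_A$ is a solution for $G_A\overset{I}{\vDash}ac_A$, then there are solutions $Q_B$ for $G_B\overset{I}{\vDash}ac_B$, $Q_C$ for $G_C\overset{I}{\vDash}ac_C$ and $Q_D$ for $G_D\overset{I}{\vDash}ac_D$ such that $Q_A=Q_B+_{Q_D}Q_C$. (Composition) If $Q_B$ is a solution for $G_B\overset{I}{\vDash}ac_B$ and $Q_C$ a solution for $G_C\overset{I}{\vDash}ac_C$ agreeing in a solution $Q_D$ for $G_D\overset{I}{\vDash}ac_D$, then there exists a solution $Q_A$ for $G_A\overset{I}{\vDash}ac_A$ with $Q_A=Q_B+_{Q_D}Q_C$.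
   Context: An $\mathcal{M}$-adhesive category $(\mathbf{C},\mathcal{M})$: a category $\mathbf{C}$ with a class $\mathcal{M}$ of monomorphisms closed under isomorphisms, composition and decomposition, such that $\mathbf{C}$ has pushouts and pullbacks along $\mathcal{M}$-morphisms, $\mathcal{M}$ is stable under pushouts and pullbacks, and the vertical VK property holds (for every commutative cube with a pushout along an $\mathcal{M}$-morphism as bottom, vertical morphisms in $\mathcal{M}$ and pullbacks as back faces, the top face is a pushout iff the front faces are pullbacks). Horizontal VK property: the same condition for cubes whose horizontal morphisms are all in $\mathcal{M}$. Effective pushouts: for $a:B\to X$, $b:C\to X$ in $\mathcal{M}$ with pullback $B\leftarrow A\to C$, the morphism to $X$ induced from the pushout of $B\leftarrow A\to C$ is in $\mathcal{M}$. Typed object over $TG$: a morphism $g:G\to TG$. Restriction of $g:G\to TG$ along $t:TG'\to TG\in\mathcal{M}$: $g':G'\to TG'$ with $G'\to G$ forming a pullback square with $t$. Restriction of a morphism between typed objects: the morphism between restricted objects forming a pullback square. With the given pushout of type objects: $g_B,g_C$ agree in $g_D$ if $g_D$ is a restriction of both; $g_A=g_B+_{g_D}g_C$ means $g_B,g_C$ agree in $g_D$, are restrictions of $g_A$, and the induced square $G_D,G_B,G_C,G_A$ is a pushout. Positive nested conditions (constraints) over $P$: $true$; $\exists(a,ac_C)$ with $a:P\to C$, $ac_C$ positive over $C$; $\bigwedge_{i\in\mathcal I}$, $\bigvee_{i\in\mathcal I}$ with $\mathcal I\ne\emptyset$. Typed over $TG$: all objects and morphisms at all nesting levels typed over $TG$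 compatibly, $t_P:P\to TG$ the typing of $P$. Restriction: $true\mapsto true$, $\exists(a,ac_C)\mapsto\exists(\mathrm{Restr}_t(a),\mathrm{Restr}_t(ac_C))$, commuting with $\bigwedge,\bigvee$. $ac_A=ac_B+_{ac_D}ac_C$ means $ac_D$ is a restriction of $ac_B$ and $ac_C$, these are restrictions of $ac_A$, and the typings of the top objects form an amalgamation $t_{P_A}=t_{P_B}+_{t_{P_D}}t_{P_C}$. Solution $Q$ for $p\vDash ac_P$ ($p:P\to G$): if $ac_P=true$, $Q=\emptyset$; if $ac_P=\exists(a,ac_C)$, $Q=(q,Q_C)$ with $q:C\to G\in\mathcal{M}$, $q\circ a=p$, $Q_C$ a solution for $q\vDash ac_C$; for $\bigwedge_i ac_{P,i}$, $Q=(Q_i)_i$ with each $Q_i$ a solution for $p\vDash ac_{P,i}$; for $\bigvee_i ac_{P,i}$, $Q=(Q_i)_i$ with $Q_j$ a solution for $p\vDash ac_{P,j}$ for some $j$ and $Q_k=\emptyset$ for $k\ne j$. Initial satisfaction: for a constraint $ac$ over the initial object $I$, $G\overset{I}{\vDash}ac$ means the unique morphism $i_G:I\to G$ satisfies $ac$; a solution for $G\overset{I}{\vDash}ac$ is a solution for $i_G\vDash ac$. Restriction of solutions is componentwise, restricting each morphism $q$ as a morphism typed over the $G$'s. $Q_B,Q_C$ agree in $Q_D$ if $Q_D$ is a restriction of both; $Q_A=Q_B+_{Q_D}Q_C$ means they agree in $Q_D$ and $Q_B,Q_C$ are restrictions of $Q_A$.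
   Formalization: The morphisms q in a solution are required to be compatible with the typings (the typing of G composed with q equals the typing of C); without this, Decomposition fails, since an untyped q need not have a restriction over the typed objects. *)

theory Defs
  imports Main
begin

section \<open>Categories\<close>

record ('o, 'm) cat =
  Obj :: "'o set"
  Mor :: "'m set"
  Dom :: "'m \<Rightarrow> 'o"
  Cod :: "'m \<Rightarrow> 'o"
  idm :: "'o \<Rightarrow> 'm"
  comp :: "'m \<Rightarrow> 'm \<Rightarrow> 'm"  (infixl "\<cdot>\<index>" 70)

definition hom :: "('o, 'm, 'z) cat_scheme \<Rightarrow> 'o \<Rightarrow> 'o \<Rightarrow> 'm set" where
  "hom C X Y = {f \<in> Mor C. Dom C f = X \<and> Cod C f = Y}"

locale category =
  fixes C :: "('o, 'm, 'z) cat_scheme" (structure)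
  assumes Dom_in: "f \<in> Mor C \<Longrightarrow> Dom C f \<in> Obj C"
    and Cod_in: "f \<in> Mor C \<Longrightarrow> Cod C f \<in> Obj C"
    and id_in: "X \<in> Obj C \<Longrightarrow> idm C X \<in> hom C X X"
    and comp_in: "f \<in> hom C X Y \<Longrightarrow> g \<in> hom C Y Z \<Longrightarrow> g \<cdot> f \<in> hom C X Z"
    and id_left: "f \<in> hom C X Y \<Longrightarrow> idm C Y \<cdot> f = f"
    and id_right: "f \<in> hom C X Y \<Longrightarrow> f \<cdot> idm C X = f"
    and assoc: "f \<in> hom C W X \<Longrightarrow> g \<in> hom C X Y \<Longrightarrow> h \<in> hom C Y Z
                 \<Longrightarrow> (h \<cdot> g) \<cdot> f = h \<cdot> (g \<cdot> f)"

definition mono :: "('o, 'm, 'z) cat_scheme \<Rightarrow> 'm \<Rightarrow> bool" where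
  "mono C m \<longleftrightarrow> m \<in> Mor C \<and>
     (\<forall>X. \<forall>f \<in> hom C X (Dom C m). \<forall>g \<in> hom C X (Dom C m).
        m \<cdot>\<^bsub>C\<^esub> f = m \<cdot>\<^bsub>C\<^esub> g \<longrightarrow> f = g)"

definition iso :: "('o, 'm, 'z) cat_scheme \<Rightarrow> 'm \<Rightarrow> bool" where
  "iso C f \<longleftrightarrow> f \<in> Mor C \<and>
     (\<exists>g \<in> hom C (Cod C f) (Dom C f).
        g \<cdot>\<^bsub>C\<^esub> f = idm C (Dom C f) \<and> f \<cdot>\<^bsub>C\<^esub> g = idm C (Cod C f))"

definition initial :: "('o, 'm, 'z) cat_scheme \<Rightarrow> 'o \<Rightarrow> bool" where
  "initial C I \<longleftrightarrow> I \<in> Obj C \<and> (\<forall>X \<in> Obj C. \<exists>!f. f \<in> hom C I X)"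

definition initial_mor :: "('o, 'm, 'z) cat_scheme \<Rightarrow> 'o \<Rightarrow> 'o \<Rightarrow> 'm" where
  "initial_mor C I X = (THE f. f \<in> hom C I X)"

text \<open>In all square predicates the order of the arguments is
  \<open>u : X \<rightarrow> Y\<close>, \<open>v : X \<rightarrow> Z\<close>, \<open>f : Y \<rightarrow> W\<close>, \<open>g : Z \<rightarrow> W\<close>.\<close>

definition comm_square :: "('o, 'm, 'z) cat_scheme \<Rightarrow> 'm \<Rightarrow> 'm \<Rightarrow> 'm \<Rightarrow> 'm \<Rightarrow> bool" where
  "comm_square C u v f g \<longleftrightarrow>
     u \<in> Mor C \<and> v \<in> Mor C \<and> f \<in> Mor C \<and> g \<in> Mor C \<and>
     Dom C u = Dom C v \<and> Cod C u = Dom C f \<and> Cod C v = Dom C g \<and> Cod C f = Cod C g \<and>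
     f \<cdot>\<^bsub>C\<^esub> u = g \<cdot>\<^bsub>C\<^esub> v"

definition pullback :: "('o, 'm, 'z) cat_scheme \<Rightarrow> 'm \<Rightarrow> 'm \<Rightarrow> 'm \<Rightarrow> 'm \<Rightarrow> bool" where
  "pullback C u v f g \<longleftrightarrow> comm_square C u v f g \<and>
     (\<forall>u' v'. comm_square C u' v' f g \<longrightarrow>
        (\<exists>!x. x \<in> hom C (Dom C u') (Dom C u) \<and> u \<cdot>\<^bsub>C\<^esub> x = u' \<and> v \<cdot>\<^bsub>C\<^esub> x = v'))"

definition pushout :: "('o, 'm, 'z) cat_scheme \<Rightarrow> 'm \<Rightarrow> 'm \<Rightarrow> 'm \<Rightarrow> 'm \<Rightarrow> bool" where
  "pushout C u v f g \<longleftrightarrow> comm_square C u v f g \<and>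
     (\<forall>f' g'. comm_square C u v f' g' \<longrightarrow>
        (\<exists>!x. x \<in> hom C (Cod C f) (Cod C f') \<and> x \<cdot>\<^bsub>C\<^esub> f = f' \<and> x \<cdot>\<^bsub>C\<^esub> g = g'))"

section \<open>\<open>\<M>\<close>-adhesive categories\<close>

text \<open>\<open>cube C f m n g f' m' n' g' a b c d\<close>: a commutative cube with bottom face
  \<open>f : A \<rightarrow> B\<close>, \<open>m : A \<rightarrow> C\<close>, \<open>n : B \<rightarrow> D\<close>, \<open>g : C \<rightarrow> D\<close>, top face \<open>f', m', n', g'\<close>
  likewise, and vertical morphisms \<open>a : A' \<rightarrow> A\<close>, \<dots>, \<open>d : D' \<rightarrow> D\<close>.
  The back faces are those containing \<open>a\<close>, the front faces those containing \<open>d\<close>.\<close>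

definition cube where
  "cube C f m n g f' m' n' g' a b c d \<longleftrightarrow>
     comm_square C f m n g \<and> comm_square C f' m' n' g' \<and>
     comm_square C f' a b f \<and> comm_square C m' a c m \<and>
     comm_square C n' b d n \<and> comm_square C g' c d g"

definition VK_cube where
  "VK_cube C f m n g f' m' n' g' a b c d \<longleftrightarrow>
     (pushout C f' m' n' g' \<longleftrightarrow> pullback C n' b d n \<and> pullback C g' c d g)"

definition vertical_VK :: "('o, 'm, 'z) cat_scheme \<Rightarrow> 'm set \<Rightarrow> bool" where
  "vertical_VK C M \<longleftrightarrow>
     (\<forall>f m n g f' m' n' g' a b c d.
        cube C f m n g f' m' n' g' a b c d \<and> pushout C f m n g \<and> m \<in> M \<and>
        {a, b, c, d} \<subseteq> M \<and> pullback C f' a b f \<and> pullback C m' a c m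
        \<longrightarrow> VK_cube C f m n g f' m' n' g' a b c d)"

definition horizontal_VK :: "('o, 'm, 'z) cat_scheme \<Rightarrow> 'm set \<Rightarrow> bool" where
  "horizontal_VK C M \<longleftrightarrow>
     (\<forall>f m n g f' m' n' g' a b c d.
        cube C f m n g f' m' n' g' a b c d \<and> pushout C f m n g \<and>
        {f, m, n, g, f', m', n', g'} \<subseteq> M \<and> pullback C f' a b f \<and> pullback C m' a c m
        \<longrightarrow> VK_cube C f m n g f' m' n' g' a b c d)"

locale M_adhesive = category C
  for C :: "('o, 'm, 'z) cat_scheme" (structure) +
  fixes M :: "'m set"
  assumes M_mono: "m \<in> M \<Longrightarrow> mono C m"
    and M_iso: "iso C i \<Longrightarrow> i \<in> M"
    and M_comp: "f \<in> M \<Longrightarrow> g \<in> M \<Longrightarrow> Cod C f = Dom C g \<Longrightarrow> g \<cdot> f \<in> M"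
    and M_decomp: "f \<in> Mor C \<Longrightarrow> g \<in> M \<Longrightarrow> Cod C f = Dom C g \<Longrightarrow> g \<cdot> f \<in> M \<Longrightarrow> f \<in> M"
    and M_pushouts: "m \<in> M \<Longrightarrow> f \<in> Mor C \<Longrightarrow> Dom C f = Dom C m \<Longrightarrow> \<exists>n g. pushout C f m n g"
    and M_pullbacks: "m \<in> M \<Longrightarrow> f \<in> Mor C \<Longrightarrow> Cod C f = Cod C m \<Longrightarrow> \<exists>u v. pullback C u v f m"
    and M_pushout_stable: "pushout C f m n g \<Longrightarrow> m \<in> M \<Longrightarrow> n \<in> M"
    and M_pullback_stable: "pullback C u v f m \<Longrightarrow> m \<in> M \<Longrightarrow> u \<in> M"
    and M_vertical_VK: "vertical_VK C M"

definition effective_pushouts :: "('o, 'm, 'z) cat_scheme \<Rightarrow> 'm set \<Rightarrow> bool" where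
  "effective_pushouts C M \<longleftrightarrow>
     (\<forall>a b u v f g x.
        a \<in> M \<and> b \<in> M \<and> pullback C u v a b \<and> pushout C u v f g \<and>
        x \<in> hom C (Cod C f) (Cod C a) \<and> x \<cdot>\<^bsub>C\<^esub> f = a \<and> x \<cdot>\<^bsub>C\<^esub> g = b
        \<longrightarrow> x \<in> M)"

section \<open>Typed objects\<close>

text \<open>Restrictions are only determined up to isomorphism, so restriction is a relation that
  records the comparison morphism. \<open>restr C t i g' g\<close> says that \<open>g' : G' \<rightarrow> TG'\<close> is a
  restriction of \<open>g : G \<rightarrow> TG\<close> along \<open>t : TG' \<rightarrow> TG\<close>, witnessed by \<open>i : G' \<rightarrow> G\<close>.
  A restriction of a morphism \<open>a : P \<rightarrow> X\<close> between typed objects, with comparison morphisms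
  \<open>i : P' \<rightarrow> P\<close> and \<open>j : X' \<rightarrow> X\<close>, is a pullback square of the same form, \<open>restr C j i a' a\<close>.\<close>

definition restr :: "('o, 'm, 'z) cat_scheme \<Rightarrow> 'm \<Rightarrow> 'm \<Rightarrow> 'm \<Rightarrow> 'm \<Rightarrow> bool" where
  "restr C t i g' g \<longleftrightarrow> pullback C i g' g t"

text \<open>The four sides of a square with corners \<open>D, B, C, A\<close>, in the order
  \<open>D \<rightarrow> B\<close>, \<open>D \<rightarrow> C\<close>, \<open>B \<rightarrow> A\<close>, \<open>C \<rightarrow> A\<close>.\<close>

type_synonym 'x sides = "'x \<times> 'x \<times> 'x \<times> 'x"

text \<open>\<open>amalg_obj C tg i gA gB gD gC\<close> stands for \<open>gA = gB +\<^bsub>gD\<^esub> gC\<close>, where \<open>tg\<close> is the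
  square of type objects and \<open>i\<close> the induced square of the typed objects.\<close>

fun amalg_obj :: "('o, 'm, 'z) cat_scheme \<Rightarrow> 'm sides \<Rightarrow> 'm sides \<Rightarrow> 'm \<Rightarrow> 'm \<Rightarrow> 'm \<Rightarrow> 'm \<Rightarrow> bool" where
  "amalg_obj C (tDB, tDC, tBA, tCA) (iDB, iDC, iBA, iCA) gA gB gD gC \<longleftrightarrow>
     restr C tDB iDB gD gB \<and> restr C tDC iDC gD gC \<and>
     restr C tBA iBA gB gA \<and> restr C tCA iCA gC gA \<and>
     pushout C iDB iDC iBA iCA"

section \<open>Positive nested conditions\<close>

text \<open>Conjunctions and disjunctions carry an index set \<open>J :: 'i set\<close> (possibly infinite);
  the values of the family outside \<open>J\<close> are irrelevant. This convention is used for all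
  families below.\<close>

datatype ('m, 'i) pcond =
    PTrue
  | PEx 'm "('m, 'i) pcond"
  | PAnd "'i set" "'i \<Rightarrow> ('m, 'i) pcond"
  | POr "'i set" "'i \<Rightarrow> ('m, 'i) pcond"

inductive pos_cond :: "('o, 'm, 'z) cat_scheme \<Rightarrow> 'o \<Rightarrow> ('m, 'i) pcond \<Rightarrow> bool" for C where
  "P \<in> Obj C \<Longrightarrow> pos_cond C P PTrue"
| "a \<in> hom C P X \<Longrightarrow> pos_cond C X ac \<Longrightarrow> pos_cond C P (PEx a ac)"
| "J \<noteq> {} \<Longrightarrow> (\<And>i. i \<in> J \<Longrightarrow> pos_cond C P (ac i)) \<Longrightarrow> pos_cond C P (PAnd J ac)"
| "J \<noteq> {} \<Longrightarrow> (\<And>i. i \<in> J \<Longrightarrow> pos_cond C P (ac i)) \<Longrightarrow> pos_cond C P (POr J ac)"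

text \<open>Typed conditions: \<open>TEx a t ac\<close> stands for \<open>\<exists>(a, ac)\<close> with \<open>a : P \<rightarrow> X\<close>, where
  \<open>t : X \<rightarrow> TG\<close> is the typing of \<open>X\<close>. The typing of the top object \<open>P\<close> is not part of the
  tree but a separate argument of the predicates below.\<close>

datatype ('m, 'i) tcond =
    TTrue
  | TEx 'm 'm "('m, 'i) tcond"
  | TAnd "'i set" "'i \<Rightarrow> ('m, 'i) tcond"
  | TOr "'i set" "'i \<Rightarrow> ('m, 'i) tcond"

primrec untyped :: "('m, 'i) tcond \<Rightarrow> ('m, 'i) pcond" where
  "untyped TTrue = PTrue"
| "untyped (TEx a t ac) = PEx a (untyped ac)"
| "untyped (TAnd J ac) = PAnd J (\<lambda>i. untyped (ac i))"
| "untyped (TOr J ac) = POr J (\<lambda>i. untyped (ac i))"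

inductive compatibly_typed ::
  "('o, 'm, 'z) cat_scheme \<Rightarrow> 'o \<Rightarrow> 'm \<Rightarrow> ('m, 'i) tcond \<Rightarrow> bool" for C TG where
  "compatibly_typed C TG tP TTrue"
| "tX \<in> hom C (Cod C a) TG \<Longrightarrow> tX \<cdot>\<^bsub>C\<^esub> a = tP \<Longrightarrow> compatibly_typed C TG tX ac
    \<Longrightarrow> compatibly_typed C TG tP (TEx a tX ac)"
| "(\<And>i. i \<in> J \<Longrightarrow> compatibly_typed C TG tP (ac i)) \<Longrightarrow> compatibly_typed C TG tP (TAnd J ac)"
| "(\<And>i. i \<in> J \<Longrightarrow> compatibly_typed C TG tP (ac i)) \<Longrightarrow> compatibly_typed C TG tP (TOr J ac)"

definition typed_cond ::
  "('o, 'm, 'z) cat_scheme \<Rightarrow> 'o \<Rightarrow> 'o \<Rightarrow> 'm \<Rightarrow> ('m, 'i) tcond \<Rightarrow> bool" where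
  "typed_cond C TG P tP ac \<longleftrightarrow>
     tP \<in> hom C P TG \<and> pos_cond C P (untyped ac) \<and> compatibly_typed C TG tP ac"

text \<open>The comparison morphisms \<open>X' \<rightarrow> X\<close> of a restricted condition, for all objects except
  the top one, form a tree of the shape of the condition.\<close>

datatype ('m, 'i) emb =
    ETrue
  | EEx 'm "('m, 'i) emb"
  | EFam "'i set" "'i \<Rightarrow> ('m, 'i) emb"

text \<open>\<open>restr_cond C t i e tP' ac' tP ac\<close>: the condition \<open>ac'\<close> with typing \<open>tP'\<close> of its top
  object is a restriction of \<open>ac\<close> with typing \<open>tP\<close> of its top object along \<open>t\<close>, with comparison
  morphism \<open>i : P' \<rightarrow> P\<close> at the top and \<open>e\<close> below.\<close>

inductive restr_cond ::
  "('o, 'm, 'z) cat_scheme \<Rightarrow> 'm \<Rightarrow> 'm \<Rightarrow> ('m, 'i) emb \<Rightarrow>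
   'm \<Rightarrow> ('m, 'i) tcond \<Rightarrow> 'm \<Rightarrow> ('m, 'i) tcond \<Rightarrow> bool" for C t where
  "restr C t i tP' tP \<Longrightarrow> restr_cond C t i ETrue tP' TTrue tP TTrue"
| "restr C t i tP' tP \<Longrightarrow> restr C t j tX' tX \<Longrightarrow> restr C j i a' a
    \<Longrightarrow> restr_cond C t j e tX' ac' tX ac
    \<Longrightarrow> restr_cond C t i (EEx j e) tP' (TEx a' tX' ac') tP (TEx a tX ac)"
| "restr C t i tP' tP \<Longrightarrow> (\<And>k. k \<in> J \<Longrightarrow> restr_cond C t i (e k) tP' (ac' k) tP (ac k))
    \<Longrightarrow> restr_cond C t i (EFam J e) tP' (TAnd J ac') tP (TAnd J ac)"
| "restr C t i tP' tP \<Longrightarrow> (\<And>k. k \<in> J \<Longrightarrow> restr_cond C t i (e k) tP' (ac' k) tP (ac k))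
    \<Longrightarrow> restr_cond C t i (EFam J e) tP' (TOr J ac') tP (TOr J ac)"

inductive emb_commute ::
  "('o, 'm, 'z) cat_scheme \<Rightarrow> ('m, 'i) emb \<Rightarrow> ('m, 'i) emb \<Rightarrow> ('m, 'i) emb \<Rightarrow> ('m, 'i) emb \<Rightarrow> bool"
  for C where
  "emb_commute C ETrue ETrue ETrue ETrue"
| "iBA \<cdot>\<^bsub>C\<^esub> iDB = iCA \<cdot>\<^bsub>C\<^esub> iDC \<Longrightarrow> emb_commute C eDB eDC eBA eCA
    \<Longrightarrow> emb_commute C (EEx iDB eDB) (EEx iDC eDC) (EEx iBA eBA) (EEx iCA eCA)"
| "(\<And>k. k \<in> J \<Longrightarrow> emb_commute C (eDB k) (eDC k) (eBA k) (eCA k))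
    \<Longrightarrow> emb_commute C (EFam J eDB) (EFam J eDC) (EFam J eBA) (EFam J eCA)"

text \<open>\<open>amalg_cond C tg i e tA acA tB acB tD acD tC acC\<close> stands for
  \<open>acA = acB +\<^bsub>acD\<^esub> acC\<close>, where \<open>i\<close> and \<open>e\<close> are the comparison morphisms at the top and below.
  As a restriction is only given up to isomorphism, four unrelated choices of comparison
  morphisms need not fit together below the top; \<open>emb_commute\<close> says that the two ways of
  regarding \<open>acD\<close> as a restriction of \<open>acA\<close>, via \<open>acB\<close> and via \<open>acC\<close>, are the same.\<close>

fun amalg_cond ::
  "('o, 'm, 'z) cat_scheme \<Rightarrow> 'm sides \<Rightarrow> 'm sides \<Rightarrow> ('m, 'i) emb sides \<Rightarrow>
   'm \<Rightarrow> ('m, 'i) tcond \<Rightarrow> 'm \<Rightarrow> ('m, 'i) tcond \<Rightarrow>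
   'm \<Rightarrow> ('m, 'i) tcond \<Rightarrow> 'm \<Rightarrow> ('m, 'i) tcond \<Rightarrow> bool" where
  "amalg_cond C (tDB, tDC, tBA, tCA) (iDB, iDC, iBA, iCA) (eDB, eDC, eBA, eCA)
     tA acA tB acB tD acD tC acC \<longleftrightarrow>
     restr_cond C tDB iDB eDB tD acD tB acB \<and> restr_cond C tDC iDC eDC tD acD tC acC \<and>
     restr_cond C tBA iBA eBA tB acB tA acA \<and> restr_cond C tCA iCA eCA tC acC tA acA \<and>
     emb_commute C eDB eDC eBA eCA \<and>
     amalg_obj C (tDB, tDC, tBA, tCA) (iDB, iDC, iBA, iCA) tA tB tD tC"

section \<open>Solutions\<close>

datatype ('m, 'i) sol =
    SEmpty
  | SEx 'm "('m, 'i) sol"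
  | SFam "'i set" "'i \<Rightarrow> ('m, 'i) sol"

inductive solution ::
  "('o, 'm, 'z) cat_scheme \<Rightarrow> 'm set \<Rightarrow> 'm \<Rightarrow> ('m, 'i) pcond \<Rightarrow> ('m, 'i) sol \<Rightarrow> bool" for C M where
  "p \<in> Mor C \<Longrightarrow> solution C M p PTrue SEmpty"
| "q \<in> hom C (Cod C a) (Cod C p) \<Longrightarrow> q \<in> M \<Longrightarrow> q \<cdot>\<^bsub>C\<^esub> a = p \<Longrightarrow> solution C M q ac Q
    \<Longrightarrow> solution C M p (PEx a ac) (SEx q Q)"
| "(\<And>i. i \<in> J \<Longrightarrow> solution C M p (ac i) (Q i)) \<Longrightarrow> solution C M p (PAnd J ac) (SFam J Q)"
| "j \<in> J \<Longrightarrow> solution C M p (ac j) (Q j) \<Longrightarrow> (\<And>k. k \<in> J \<Longrightarrow> k \<noteq> j \<Longrightarrow> Q k = SEmpty)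
    \<Longrightarrow> solution C M p (POr J ac) (SFam J Q)"

text \<open>For a typed condition and an object \<open>G\<close> typed by \<open>g : G \<rightarrow> TG\<close>, the morphisms
  \<open>q : X \<rightarrow> G\<close> of a solution are morphisms between typed objects: \<open>g \<circ> q\<close> is the typing
  of \<open>X\<close>. Only then can \<open>q\<close> be restricted as a morphism between typed objects.\<close>

inductive sol_typed ::
  "('o, 'm, 'z) cat_scheme \<Rightarrow> 'm \<Rightarrow> ('m, 'i) tcond \<Rightarrow> ('m, 'i) sol \<Rightarrow> bool" for C g where
  "sol_typed C g ac SEmpty"
| "g \<cdot>\<^bsub>C\<^esub> q = tX \<Longrightarrow> sol_typed C g ac Q \<Longrightarrow> sol_typed C g (TEx a tX ac) (SEx q Q)"
| "(\<And>i. i \<in> J \<Longrightarrow> sol_typed C g (ac i) (Q i)) \<Longrightarrow> sol_typed C g (TAnd J ac) (SFam J Q)"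
| "(\<And>i. i \<in> J \<Longrightarrow> sol_typed C g (ac i) (Q i)) \<Longrightarrow> sol_typed C g (TOr J ac) (SFam J Q)"

definition init_solution ::
  "('o, 'm, 'z) cat_scheme \<Rightarrow> 'm set \<Rightarrow> 'o \<Rightarrow> 'm \<Rightarrow> ('m, 'i) tcond \<Rightarrow> ('m, 'i) sol \<Rightarrow> bool" where
  "init_solution C M I g ac Q \<longleftrightarrow>
     solution C M (initial_mor C I (Dom C g)) (untyped ac) Q \<and> sol_typed C g ac Q"

text \<open>\<open>restr_sol C i e Q' Q\<close>: \<open>Q'\<close> is a restriction of \<open>Q\<close> along \<open>i : G' \<rightarrow> G\<close>, where \<open>e\<close>
  consists of the comparison morphisms of the underlying restriction of conditions.\<close>

inductive restr_sol ::
  "('o, 'm, 'z) cat_scheme \<Rightarrow> 'm \<Rightarrow> ('m, 'i) emb \<Rightarrow> ('m, 'i) sol \<Rightarrow> ('m, 'i) sol \<Rightarrow> bool"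
  for C i where
  "restr_sol C i e SEmpty SEmpty"
| "restr C i j q' q \<Longrightarrow> restr_sol C i e Q' Q \<Longrightarrow> restr_sol C i (EEx j e) (SEx q' Q') (SEx q Q)"
| "(\<And>k. k \<in> J \<Longrightarrow> restr_sol C i (e k) (Q' k) (Q k))
    \<Longrightarrow> restr_sol C i (EFam J e) (SFam J Q') (SFam J Q)"

text \<open>\<open>agree_sol C i e QB QD QC\<close>: \<open>QB\<close> and \<open>QC\<close> agree in \<open>QD\<close>;
  \<open>amalg_sol C i e QA QB QD QC\<close>: \<open>QA = QB +\<^bsub>QD\<^esub> QC\<close>.\<close>

fun agree_sol ::
  "('o, 'm, 'z) cat_scheme \<Rightarrow> 'm sides \<Rightarrow> ('m, 'i) emb sides \<Rightarrow>
   ('m, 'i) sol \<Rightarrow> ('m, 'i) sol \<Rightarrow> ('m, 'i) sol \<Rightarrow> bool" where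
  "agree_sol C (iDB, iDC, iBA, iCA) (eDB, eDC, eBA, eCA) QB QD QC \<longleftrightarrow>
     restr_sol C iDB eDB QD QB \<and> restr_sol C iDC eDC QD QC"

fun amalg_sol ::
  "('o, 'm, 'z) cat_scheme \<Rightarrow> 'm sides \<Rightarrow> ('m, 'i) emb sides \<Rightarrow>
   ('m, 'i) sol \<Rightarrow> ('m, 'i) sol \<Rightarrow> ('m, 'i) sol \<Rightarrow> ('m, 'i) sol \<Rightarrow> bool" where
  "amalg_sol C (iDB, iDC, iBA, iCA) (eDB, eDC, eBA, eCA) QA QB QD QC \<longleftrightarrow>
     agree_sol C (iDB, iDC, iBA, iCA) (eDB, eDC, eBA, eCA) QB QD QC \<and>
     restr_sol C iBA eBA QB QA \<and> restr_sol C iCA eCA QC QA"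

end

theory Submission
  imports Defs
begin

text \<open>Decomposition restricts every morphism \<open>q\<^sub>A : X\<^sub>A \<rightarrow> G\<^sub>A\<close> of a solution along the pullbacks
  \<open>G\<^sub>B\<close>, \<open>G\<^sub>C\<close>, \<open>G\<^sub>D\<close> of \<open>G\<^sub>A\<close>; the result lies in \<open>\<M>\<close> by stability under pullbacks. For
  composition, the horizontal VK property lifts the pushout of type objects to a pushout
  \<open>X\<^sub>A\<close> of \<open>X\<^sub>B\<close> and \<open>X\<^sub>C\<close> over \<open>X\<^sub>D\<close> at every level of the condition, which induces \<open>q\<^sub>A\<close>.
  As pushouts along \<open>\<M>\<close>-morphisms are pullbacks, \<open>X\<^sub>D\<close> is the intersection of \<open>X\<^sub>B\<close> and
  \<open>X\<^sub>C\<close> in \<open>G\<^sub>A\<close>, so \<open>q\<^sub>A\<close> lies in \<open>\<M>\<close> by effectiveness of pushouts.\<close>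

section \<open>Calculus of pullback and pushout squares in a category\<close>

context category
begin

lemma comp_simps [simp]:
  assumes "f \<in> Mor C" "g \<in> Mor C" "Cod C f = Dom C g"
  shows "g \<cdot> f \<in> Mor C" "Dom C (g \<cdot> f) = Dom C f" "Cod C (g \<cdot> f) = Cod C g"
  using comp_in[of f "Dom C f" "Cod C f" g "Cod C g"] assms by (auto simp: hom_def)

lemma comp_assoc:
  assumes "f \<in> Mor C" "g \<in> Mor C" "h \<in> Mor C" "Cod C f = Dom C g" "Cod C g = Dom C h"
  shows "h \<cdot> g \<cdot> f = h \<cdot> (g \<cdot> f)"
  using assms by (intro assoc[of f "Dom C f" "Cod C f" g "Cod C g" h "Cod C h"]) (auto simp: hom_def)

lemma id_simps [simp]:
  assumes "X \<in> Obj C"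
  shows "idm C X \<in> Mor C" "Dom C (idm C X) = X" "Cod C (idm C X) = X"
  using id_in[OF assms] by (auto simp: hom_def)

lemma comp_id [simp]:
  assumes "f \<in> Mor C"
  shows "Dom C f = X \<Longrightarrow> f \<cdot> idm C X = f" "Cod C f = X \<Longrightarrow> idm C X \<cdot> f = f"
  using assms id_left id_right by (auto simp: hom_def)

lemma mono_cancel:
  assumes "mono C m" "f \<in> Mor C" "g \<in> Mor C" "Dom C f = Dom C g"
    and "Cod C f = Dom C m" "Cod C g = Dom C m" "m \<cdot> f = m \<cdot> g"
  shows "f = g"
  using assms unfolding mono_def hom_def by blast

lemma comm_squareD:
  assumes "comm_square C u v f g"
  shows "u \<in> Mor C" "v \<in> Mor C" "f \<in> Mor C" "g \<in> Mor C" "Dom C v = Dom C u"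
    "Cod C u = Dom C f" "Cod C v = Dom C g" "Cod C g = Cod C f" "f \<cdot> u = g \<cdot> v"
  using assms by (auto simp: comm_square_def)

lemma pullback_comm: "pullback C u v f g \<Longrightarrow> comm_square C u v f g"
  by (simp add: pullback_def)

lemma pushout_comm: "pushout C u v f g \<Longrightarrow> comm_square C u v f g"
  by (simp add: pushout_def)

lemmas pullbackD = comm_squareD[OF pullback_comm]
lemmas pushoutD = comm_squareD[OF pushout_comm]
lemmas restrD = pullbackD[folded restr_def]

lemma comm_square_sym: "comm_square C u v f g \<longleftrightarrow> comm_square C v u g f"
  by (auto simp: comm_square_def)

lemma pullback_sym: "pullback C u v f g \<Longrightarrow> pullback C v u g f"
  unfolding pullback_def by (simp add: comm_square_sym[of v u] comm_square_sym[of _ _ g f])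
    (metis comm_squareD(5))

lemma pullback_lift:
  assumes "pullback C u v f g" "comm_square C u' v' f g"
  obtains x where "x \<in> Mor C" "Dom C x = Dom C u'" "Cod C x = Dom C u" "u \<cdot> x = u'" "v \<cdot> x = v'"
  using assms unfolding pullback_def hom_def by blast

lemma pullback_eqI:
  assumes "pullback C u v f g" "x \<in> Mor C" "y \<in> Mor C" "Dom C x = Dom C y"
    and "Cod C x = Dom C u" "Cod C y = Dom C u" "u \<cdot> x = u \<cdot> y" "v \<cdot> x = v \<cdot> y"
  shows "x = y"
proof -
  note P = pullbackD[OF assms(1)]
  have "comm_square C (u \<cdot> y) (v \<cdot> y) f g"
    using assms P by (simp add: comm_square_def flip: comp_assoc)
  then have "\<exists>!z. z \<in> hom C (Dom C (u \<cdot> y)) (Dom C u) \<and> u \<cdot> z = u \<cdot> y \<and> v \<cdot> z = v \<cdot> y"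
    using assms(1) by (simp add: pullback_def)
  moreover have "Dom C (u \<cdot> y) = Dom C y"
    using assms P by simp
  ultimately show ?thesis
    using assms by (metis (mono_tags, lifting) hom_def mem_Collect_eq)
qed

lemma pushout_lift:
  assumes "pushout C u v f g" "comm_square C u v f' g'"
  obtains x where "x \<in> Mor C" "Dom C x = Cod C f" "Cod C x = Cod C f'" "x \<cdot> f = f'" "x \<cdot> g = g'"
  using assms unfolding pushout_def hom_def by blast

lemma pushout_eqI:
  assumes "pushout C u v f g" "x \<in> Mor C" "y \<in> Mor C" "Dom C x = Cod C f" "Dom C y = Cod C f"
    and "Cod C x = Cod C y" "x \<cdot> f = y \<cdot> f" "x \<cdot> g = y \<cdot> g"
  shows "x = y"
proof -
  note P = pushoutD[OF assms(1)]
  have "comm_square C u v (y \<cdot> f) (y \<cdot> g)"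
    using assms P by (simp add: comm_square_def comp_assoc)
  then have "\<exists>!z. z \<in> hom C (Cod C f) (Cod C (y \<cdot> f)) \<and> z \<cdot> f = y \<cdot> f \<and> z \<cdot> g = y \<cdot> g"
    using assms(1) by (simp add: pushout_def)
  moreover have "Cod C (y \<cdot> f) = Cod C y"
    using assms P by simp
  ultimately show ?thesis
    using assms by (metis (mono_tags, lifting) hom_def mem_Collect_eq)
qed

text \<open>One half of the pasting law for pullbacks. Composing a cone over \<open>q\<close> and
  \<open>i\<close> with \<open>g'\<close> gives a cone over the outer cospan, hence a lift
  \<open>x\<close>. It satisfies \<open>q' \<cdot> x = v\<close> because both sides agree after the
  two projections \<open>i\<close> and \<open>g'\<close> of the right-hand pullback.\<close>

lemma pullback_cancel:
  assumes outer: "pullback C j (g' \<cdot> q') (g \<cdot> q) t" and right: "pullback C i g' g t"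
    and left: "comm_square C j q' q i"
  shows "pullback C j q' q i"
  unfolding pullback_def
proof (intro conjI allI impI left)
  fix u v assume uv: "comm_square C u v q i"
  note L = comm_squareD[OF left] and R = pullbackD[OF right] and V = comm_squareD[OF uv]
  have eqs: "g' \<cdot> v \<in> Mor C" "g \<cdot> q \<cdot> u = t \<cdot> (g' \<cdot> v)"
    using L R V by (simp, metis comp_assoc)
  then have "comm_square C u (g' \<cdot> v) (g \<cdot> q) t"
    using L R V by (simp add: comm_square_def)
  then obtain x where x: "x \<in> Mor C" "Dom C x = Dom C u" "Cod C x = Dom C j"
      "j \<cdot> x = u" "g' \<cdot> q' \<cdot> x = g' \<cdot> v"
    using pullback_lift[OF outer] by metis
  have "q' \<cdot> x = v"
  proof (rule pullback_eqI[OF right])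
    show "i \<cdot> (q' \<cdot> x) = i \<cdot> v"
      using x L V by (metis comp_assoc)
    show "g' \<cdot> (q' \<cdot> x) = g' \<cdot> v"
      using x L R by (simp add: comp_assoc)
  qed (use x L R V in simp_all)
  then have "x \<in> hom C (Dom C u) (Dom C j) \<and> j \<cdot> x = u \<and> q' \<cdot> x = v"
    using x by (simp add: hom_def)
  moreover have "y = x" if "y \<in> hom C (Dom C u) (Dom C j) \<and> j \<cdot> y = u \<and> q' \<cdot> y = v" for y
  proof (rule pullback_eqI[OF outer])
    show "g' \<cdot> q' \<cdot> y = g' \<cdot> q' \<cdot> x"
      using x L R that by (simp add: comp_assoc hom_def)
  qed (use x that in \<open>simp_all add: hom_def\<close>)
  ultimately show "\<exists>!x. x \<in> hom C (Dom C u) (Dom C j) \<and> j \<cdot> x = u \<and> q' \<cdot> x = v"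
    by blast
qed

text \<open>The first of three degenerate squares that become faces of the cube in
  \<open>M_pushout_pullback\<close>; the lift of a cone is its leg \<open>v\<close>.\<close>

lemma pullback_id_left:
  assumes f: "f \<in> Mor C"
  shows "pullback C f (idm C (Dom C f)) (idm C (Cod C f)) f"
  unfolding pullback_def
proof (intro conjI allI impI)
  show "comm_square C f (idm C (Dom C f)) (idm C (Cod C f)) f"
    using f by (simp add: comm_square_def Dom_in Cod_in)
  fix u v assume "comm_square C u v (idm C (Cod C f)) f"
  note U = comm_squareD[OF this]
  have "Cod C u = Cod C f"
    using U(6) f by (simp add: Cod_in)
  then have "f \<cdot> v = u"
    using U(9) by (simp add: U(1))
  then show "\<exists>!x. x \<in> hom C (Dom C u) (Dom C f) \<and> f \<cdot> x = u \<and> idm C (Dom C f) \<cdot> x = v"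
    using U(2,5,7) f by (intro ex1I[of _ v]) (simp_all add: hom_def, metis comp_id(2))
qed

lemma pullback_of_mono:
  assumes "mono C m"
  shows "pullback C (idm C (Dom C m)) (idm C (Dom C m)) m m"
  unfolding pullback_def
proof (intro conjI allI impI)
  have m: "m \<in> Mor C"
    using assms by (simp add: mono_def)
  then show "comm_square C (idm C (Dom C m)) (idm C (Dom C m)) m m"
    by (simp add: comm_square_def Dom_in)
  fix u v assume "comm_square C u v m m"
  note U = comm_squareD[OF this]
  have "u = v"
    using mono_cancel[OF assms, of u v] U by simp
  then show "\<exists>!x. x \<in> hom C (Dom C u) (Dom C (idm C (Dom C m))) \<and>
      idm C (Dom C m) \<cdot> x = u \<and> idm C (Dom C m) \<cdot> x = v"
    using U(2,6,7) m by (intro ex1I[of _ v]) (simp_all add: Dom_in hom_def, metis comp_id(2))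
qed

lemma pushout_id:
  assumes f: "f \<in> Mor C"
  shows "pushout C f (idm C (Dom C f)) (idm C (Cod C f)) f"
  unfolding pushout_def
proof (intro conjI allI impI)
  show "comm_square C f (idm C (Dom C f)) (idm C (Cod C f)) f"
    using f by (simp add: comm_square_def Dom_in Cod_in)
  fix u v assume "comm_square C f (idm C (Dom C f)) u v"
  note U = comm_squareD[OF this]
  have "u \<cdot> f = v"
    using U(7,9) f by (simp add: U(4) Dom_in)
  then show "\<exists>!x. x \<in> hom C (Cod C (idm C (Cod C f))) (Cod C u) \<and>
      x \<cdot> idm C (Cod C f) = u \<and> x \<cdot> f = v"
    using U(3) U(6)[symmetric] f by (intro ex1I[of _ u]) (simp_all add: hom_def Cod_in, metis comp_id(1))
qed

section \<open>Restriction of morphisms between typed objects\<close>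

text \<open>Since \<open>q\<close> respects the typings, \<open>q \<cdot> j\<close> and
  \<open>x'\<close> form a cone over \<open>g\<close> and \<open>t\<close>, and its lift is
  \<open>q'\<close>. The outer square is the restriction of \<open>x\<close>, so cancelling the
  restriction of \<open>g\<close> leaves a pullback.\<close>

lemma restr_mor:
  assumes G: "restr C t i g' g" and X: "restr C t j x' x"
    and q: "q \<in> Mor C" "Dom C q = Dom C x" "Cod C q = Dom C g" "g \<cdot> q = x"
  obtains q' where "restr C i j q' q" "g' \<cdot> q' = x'"
proof -
  note G' = restrD[OF G] and X' = restrD[OF X]
  have "g \<cdot> (q \<cdot> j) = t \<cdot> x'"
    using G' X' q by (metis comp_assoc)
  then have "comm_square C (q \<cdot> j) x' g t"
    using G' X' q by (simp add: comm_square_def)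
  then obtain q' where q': "q' \<in> Mor C" "Dom C q' = Dom C j" "Cod C q' = Dom C i"
      "i \<cdot> q' = q \<cdot> j" "g' \<cdot> q' = x'"
    using pullback_lift[OF G[unfolded restr_def]] X' q by (metis comp_simps(2))
  have "comm_square C j q' q i"
    using q q' X' G' by (simp add: comm_square_def)
  then have "restr C i j q' q"
    using pullback_cancel[of j g' q' g q t i] G X q q' by (simp add: restr_def)
  then show thesis
    using q' that by blast
qed

text \<open>A commuting square is automatically a pullback once both morphisms respect the typings,
  again by cancelling the restriction of \<open>g\<close>.\<close>

lemma restr_morI:
  assumes G: "restr C t i g' g" and X: "restr C t j x' x"
    and "g \<cdot> q = x" "g' \<cdot> q' = x'" "comm_square C j q' q i"
  shows "restr C i j q' q"
  using pullback_cancel[of j g' q' g q t i] assms by (simp add: restr_def)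

end

section \<open>Pushouts along morphisms in \<open>M\<close> are pullbacks\<close>

context M_adhesive
begin

lemma M_Mor: "m \<in> M \<Longrightarrow> m \<in> Mor C"
  using M_mono by (auto simp: mono_def)

lemma id_M: "X \<in> Obj C \<Longrightarrow> idm C X \<in> M"
  by (rule M_iso) (auto simp: iso_def hom_def intro!: bexI[of _ "idm C X"])

lemma restr_M: "restr C t i q' q \<Longrightarrow> q \<in> M \<Longrightarrow> q' \<in> M"
  unfolding restr_def by (metis pullback_sym M_pullback_stable)

text \<open>The vertical VK property applied to the cube over the given pushout whose vertical
  morphisms are \<open>id\<close>, \<open>id\<close>, \<open>m\<close>, \<open>n\<close>; one of its front faces is the pushout square itself.\<close>

lemma M_pushout_pullback:
  assumes po: "pushout C f m n g" and m: "m \<in> M"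
  shows "pullback C f m n g"
proof -
  note P = pushoutD[OF po]
  let ?A = "Dom C f" and ?B = "Cod C f"
  have n: "n \<in> M"
    using M_pushout_stable[OF po m] .
  have pbs: "pullback C f (idm C ?A) (idm C ?B) f" "pullback C (idm C ?A) (idm C ?A) m m"
    "pullback C (idm C ?B) (idm C ?B) n n"
    using pullback_id_left[OF P(1)] pullback_of_mono[OF M_mono[OF m]]
      pullback_of_mono[OF M_mono[OF n]] by (simp_all only: P(5,6))
  have "cube C f m n g f (idm C ?A) (idm C ?B) f (idm C ?A) (idm C ?B) m n"
    unfolding cube_def using pushout_comm[OF po] pushout_comm[OF pushout_id[OF P(1)]] pbs
    by (blast intro: pullback_comm)
  moreover have "{idm C ?A, idm C ?B, m, n} \<subseteq> M"
    using P(1) m n by (simp add: id_M Dom_in Cod_in)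
  ultimately have "VK_cube C f m n g f (idm C ?A) (idm C ?B) f (idm C ?A) (idm C ?B) m n"
    using po m pbs by (intro M_vertical_VK[unfolded vertical_VK_def, rule_format] conjI)
  then show ?thesis
    using pushout_id[OF P(1)] by (simp add: VK_cube_def)
qed

end

section \<open>Decomposing and composing single morphisms over a fixed amalgamation of typed
  objects\<close>

locale typed_amalgamation = M_adhesive C M
  for C :: "('o, 'm, 'z) cat_scheme" (structure) and M :: "'m set" +
  fixes tDB tDC tBA tCA gDB gDC gBA gCA gA gB gC gD :: 'm
  assumes hVK: "horizontal_VK C M" and effective: "effective_pushouts C M"
    and t_M: "tDB \<in> M" "tDC \<in> M" "tBA \<in> M" "tCA \<in> M"
    and t_pushout: "pushout C tDB tDC tBA tCA"
    and g_restr: "restr C tDB gDB gD gB" "restr C tDC gDC gD gC"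
      "restr C tBA gBA gB gA" "restr C tCA gCA gC gA"
    and g_pushout: "pushout C gDB gDC gBA gCA"
begin

text \<open>An amalgamation whose pushout is to be derived rather than demanded: below the top of a
  condition only restrictions and commuting comparison morphisms are given.\<close>

definition typed_square where
  "typed_square jDB jDC jBA jCA xA xB xC xD \<longleftrightarrow>
     restr C tDB jDB xD xB \<and> restr C tDC jDC xD xC \<and>
     restr C tBA jBA xB xA \<and> restr C tCA jCA xC xA \<and> jBA \<cdot> jDB = jCA \<cdot> jDC"

text \<open>Commutativity instead of pullbacks, since this is what initiality directly gives at the
  top of a constraint.\<close>

definition mor_square where
  "mor_square jDB jDC jBA jCA qA qB qC qD \<longleftrightarrow>
     comm_square C jDB qD qB gDB \<and> comm_square C jDC qD qC gDC \<and>
     comm_square C jBA qB qA gBA \<and> comm_square C jCA qC qA gCA"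

lemma restr_t_M: "restr C t j x' x \<Longrightarrow> t \<in> M \<Longrightarrow> j \<in> M"
  unfolding restr_def by (rule M_pullback_stable)

lemma g_M: "gDB \<in> M" "gDC \<in> M" "gBA \<in> M" "gCA \<in> M"
  using g_restr t_M restr_t_M by blast+

lemmas g_square = pushoutD[OF g_pushout]

text \<open>Consider the cube whose bottom is the pushout of type objects and whose vertical
  morphisms are the typings. All its side faces are pullbacks, and stability puts the top morphisms
  into \<open>M\<close>. The typings are arbitrary morphisms, so it is the horizontal VK property
  that makes the top a pushout.\<close>

lemma typed_square_pushout:
  assumes "typed_square jDB jDC jBA jCA xA xB xC xD"
  shows "pushout C jDB jDC jBA jCA"
proof -
  have r: "pullback C jDB xD xB tDB" "pullback C jDC xD xC tDC"
     "pullback C jBA xB xA tBA" "pullback C jCA xC xA tCA" "jBA \<cdot> jDB = jCA \<cdot> jDC"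
    using assms by (auto simp: typed_square_def restr_def)
  have M: "{tDB, tDC, tBA, tCA, jDB, jDC, jBA, jCA} \<subseteq> M"
    using r t_M M_pullback_stable by blast
  have "comm_square C jDB jDC jBA jCA"
    unfolding comm_square_def using r(5) pullbackD[OF r(1)] pullbackD[OF r(2)]
      pullbackD[OF r(3)] pullbackD[OF r(4)] by simp
  then have "cube C tDB tDC tBA tCA jDB jDC jBA jCA xD xB xC xA"
    using r pushout_comm[OF t_pushout] by (simp add: cube_def pullback_comm)
  then have "VK_cube C tDB tDC tBA tCA jDB jDC jBA jCA xD xB xC xA"
    using t_pushout M r(1,2) by (intro hVK[unfolded horizontal_VK_def, rule_format] conjI)
  then show ?thesis
    using r by (simp add: VK_cube_def)
qed

lemma restr_mor_square:
  "restr C gDB jDB qD qB \<Longrightarrow> restr C gDC jDC qD qC \<Longrightarrow> restr C gBA jBA qB qA \<Longrightarrow>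
    restr C gCA jCA qC qA \<Longrightarrow> mor_square jDB jDC jBA jCA qA qB qC qD"
  by (simp add: mor_square_def restr_def pullback_comm)

text \<open>\<open>qB\<close> and \<open>qC\<close> are restricted from \<open>qA\<close>, and
  \<open>qD\<close> from \<open>qB\<close>. That \<open>qD\<close> also restricts \<open>qC\<close>
  has to be proved: the square commutes, and \<open>restr_morI\<close> makes it a pullback.\<close>

lemma decompose_mor:
  assumes X: "typed_square jDB jDC jBA jCA xA xB xC xD"
    and q: "qA \<in> Mor C" "Dom C qA = Dom C xA" "Cod C qA = Dom C gA" "gA \<cdot> qA = xA"
  obtains qB qC qD where "restr C gDB jDB qD qB" "restr C gDC jDC qD qC"
    "restr C gBA jBA qB qA" "restr C gCA jCA qC qA"
    "gB \<cdot> qB = xB" "gC \<cdot> qC = xC" "gD \<cdot> qD = xD"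
proof -
  have x: "restr C tDB jDB xD xB" "restr C tDC jDC xD xC"
     "restr C tBA jBA xB xA" "restr C tCA jCA xC xA" "jBA \<cdot> jDB = jCA \<cdot> jDC"
    using X by (auto simp: typed_square_def)
  obtain qB where B: "restr C gBA jBA qB qA" "gB \<cdot> qB = xB"
    using restr_mor[OF g_restr(3) x(3) q] .
  obtain qC where C: "restr C gCA jCA qC qA" "gC \<cdot> qC = xC"
    using restr_mor[OF g_restr(4) x(4) q] .
  note B' = restrD[OF B(1)] and C' = restrD[OF C(1)]
  have "Dom C qB = Dom C xB"
    using B' restrD[OF x(3)] by simp
  then obtain qD where D: "restr C gDB jDB qD qB" "gD \<cdot> qD = xD"
    using restr_mor[OF g_restr(1) x(1), of qB] B' B(2) restrD[OF g_restr(1)] restrD[OF g_restr(3)]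
    by metis
  note D' = restrD[OF D(1)] and G = g_square and J = restrD[OF x(1)] restrD[OF x(2)]
  \<comment> \<open>Both sides agree after the monomorphism \<open>gCA\<close>, because both routes
    from the \<open>D\<close> corner to the \<open>A\<close> corner lead to the same
    morphism.\<close>
  have "gDC \<cdot> qD = qC \<cdot> jDC"
  proof (rule mono_cancel[OF M_mono[OF g_M(4)]])
    have "gCA \<cdot> (gDC \<cdot> qD) = gBA \<cdot> (gDB \<cdot> qD)"
      using D' G by (metis comp_assoc)
    also have "\<dots> = gBA \<cdot> qB \<cdot> jDB"
      using B' D' by (simp add: comp_assoc)
    also have "\<dots> = qA \<cdot> (jBA \<cdot> jDB)"
      using B' D' by (metis comp_assoc)
    also have "\<dots> = gCA \<cdot> qC \<cdot> jDC"
      unfolding x(5) using C' J restrD[OF x(4)] by (metis comp_assoc)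
    finally show "gCA \<cdot> (gDC \<cdot> qD) = gCA \<cdot> (qC \<cdot> jDC)"
      using C' J restrD[OF x(4)] by (simp add: comp_assoc)
  qed (use C' D' G J restrD[OF x(4)] in simp_all)
  then have "comm_square C jDC qD qC gDC"
    using C' D' G J restrD[OF x(4)] by (simp add: comm_square_def)
  then have "restr C gDC jDC qD qC"
    using restr_morI[OF g_restr(2) x(2)] C(2) D(2) by blast
  then show thesis
    using that B C D by blast
qed

text \<open>\<open>qA\<close> is induced by the pushout that \<open>typed_square_pushout\<close>
  provides. Its typing is checked on the two legs \<open>jBA\<close> and \<open>jCA\<close>, after
  which \<open>restr_morI\<close> upgrades the commuting squares to restrictions.\<close>

lemma compose_mor:
  assumes X: "typed_square jDB jDC jBA jCA xA xB xC xD"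
    and r: "restr C gDB jDB qD qB" "restr C gDC jDC qD qC"
    and M: "qB \<in> M" "qC \<in> M" and x_eq: "gB \<cdot> qB = xB" "gC \<cdot> qC = xC"
  obtains qA where "qA \<in> M" "Dom C qA = Dom C xA" "Cod C qA = Dom C gA" "gA \<cdot> qA = xA"
    "restr C gBA jBA qB qA" "restr C gCA jCA qC qA"
proof -
  have x: "restr C tDB jDB xD xB" "restr C tDC jDC xD xC"
     "restr C tBA jBA xB xA" "restr C tCA jCA xC xA" "jBA \<cdot> jDB = jCA \<cdot> jDC"
    using X by (auto simp: typed_square_def)
  note po = typed_square_pushout[OF X]
  note B = restrD[OF r(1)] and C = restrD[OF r(2)] and G = g_square and J = pushoutD[OF po]
    and xB = restrD[OF x(3)] and xC = restrD[OF x(4)]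
    and gB = restrD[OF g_restr(3)] and gC = restrD[OF g_restr(4)]
  have "gBA \<cdot> qB \<cdot> jDB = gCA \<cdot> qC \<cdot> jDC"
    using B C G by (metis comp_assoc)
  then have cs: "comm_square C jDB jDC (gBA \<cdot> qB) (gCA \<cdot> qC)"
    using B C G by (simp add: comm_square_def)
  then obtain qA where A: "qA \<in> Mor C" "Dom C qA = Cod C jBA" "Cod C qA = Cod C (gBA \<cdot> qB)"
      "qA \<cdot> jBA = gBA \<cdot> qB" "qA \<cdot> jCA = gCA \<cdot> qC"
    using pushout_lift[OF po] by blast
  have A': "Dom C qA = Dom C xA" "Cod C qA = Dom C gA"
    using A(2,3) xB(6) gB(6) B(3,8) G(3,6) by (metis comp_simps(3))+
  have ty: "gA \<cdot> qA = xA"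
  proof (rule pushout_eqI[OF po])
    have "gA \<cdot> qA \<cdot> jBA = gA \<cdot> gBA \<cdot> qB"
      using A(1,2,4) A'(2) B(3,8) J(3) G(3,6) gB(3,6) by (metis comp_assoc)
    also have "\<dots> = xA \<cdot> jBA"
      using B(3,8) G(6) gB(1,2,4,5,7,9) xB(9) x_eq(1) by (metis comp_assoc)
    finally show "gA \<cdot> qA \<cdot> jBA = xA \<cdot> jBA" .
    have "gA \<cdot> qA \<cdot> jCA = gA \<cdot> gCA \<cdot> qC"
      using A(1,2,5) A'(2) C(3,8) J(4,8) G(4,7) gC(3,6) by (metis comp_assoc)
    also have "\<dots> = xA \<cdot> jCA"
      using C(3,8) G(7) gC(1,2,4,5,7,9) xC(9) x_eq(2) by (metis comp_assoc)
    finally show "gA \<cdot> qA \<cdot> jCA = xA \<cdot> jCA" .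
    show "gA \<cdot> qA \<in> Mor C" "Dom C (gA \<cdot> qA) = Cod C jBA" "Cod C (gA \<cdot> qA) = Cod C xA"
      using A(1,2) A'(2) gB(3,8) xB(8) by simp_all
  qed (use xB(3,6) in simp_all)
  have "comm_square C jBA qB qA gBA" "comm_square C jCA qC qA gCA"
    unfolding comm_square_def
    using A A' B(3,6,8) C(3,6,8) J(3,4,6,7,8) G(3,4,6,7,8) gB(6) by metis+
  then have "restr C gBA jBA qB qA" "restr C gCA jCA qC qA"
    using restr_morI[OF g_restr(3) x(3) ty x_eq(1)] restr_morI[OF g_restr(4) x(4) ty x_eq(2)]
    by blast+
  moreover have "qA \<in> M"
  proof -
    \<comment> \<open>Effectiveness needs the pushout to be taken over the intersection in the
      domain of \<open>gA\<close>. A cone \<open>u\<close>, \<open>v\<close> first yields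
      \<open>w\<close> into the domain of \<open>gD\<close>, because the square of the
      \<open>g\<close> comparison morphisms is a pullback; then \<open>u\<close> and
      \<open>w\<close> factor through the restriction \<open>qD\<close> of
      \<open>qB\<close>.\<close>
    have "pullback C jDB jDC (gBA \<cdot> qB) (gCA \<cdot> qC)"
      unfolding pullback_def
    proof (intro conjI allI impI cs)
      fix u v assume uv: "comm_square C u v (gBA \<cdot> qB) (gCA \<cdot> qC)"
      have U: "u \<in> Mor C" "v \<in> Mor C" "Dom C v = Dom C u" "Cod C u = Dom C qB" "Cod C v = Dom C qC"
        "gBA \<cdot> (qB \<cdot> u) = gCA \<cdot> (qC \<cdot> v)"
        using comm_squareD[OF uv] B C G by (simp_all add: comp_assoc)
      then have "comm_square C (qB \<cdot> u) (qC \<cdot> v) gBA gCA"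
        using B C G by (simp add: comm_square_def)
      then obtain w where w: "w \<in> Mor C" "Dom C w = Dom C u" "Cod C w = Dom C gDB"
          "gDB \<cdot> w = qB \<cdot> u" "gDC \<cdot> w = qC \<cdot> v"
        using pullback_lift[OF M_pushout_pullback[OF g_pushout g_M(2)]] U B by (metis comp_simps(2))
      then have "comm_square C u w qB gDB"
        using U B by (simp add: comm_square_def)
      then obtain y where y: "y \<in> Mor C" "Dom C y = Dom C u" "Cod C y = Dom C jDB"
          "jDB \<cdot> y = u" "qD \<cdot> y = w"
        using pullback_lift[OF r(1)[unfolded restr_def]] by metis
      \<comment> \<open>The lift \<open>y\<close> was built from the \<open>B\<close> side; its
        \<open>C\<close> component is determined since \<open>qC\<close> is a monomorphism.\<close>
      have "jDC \<cdot> y = v"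
      proof (rule mono_cancel[OF M_mono[OF M(2)]])
        show "qC \<cdot> (jDC \<cdot> y) = qC \<cdot> v"
          using y w C B by (metis comp_assoc)
      qed (use y U C B J in simp_all)
      moreover have "z = y" if "z \<in> hom C (Dom C u) (Dom C jDB)" "jDB \<cdot> z = u" for z
      proof (rule mono_cancel)
        show "mono C jDB"
          using M_mono restr_t_M[OF x(1)] t_M by blast
      qed (use that y in \<open>simp_all add: hom_def\<close>)
      moreover have "y \<in> hom C (Dom C u) (Dom C jDB)"
        using y by (simp add: hom_def)
      ultimately show "\<exists>!y. y \<in> hom C (Dom C u) (Dom C jDB) \<and> jDB \<cdot> y = u \<and> jDC \<cdot> y = v"
        using y(4) by blast
    qed
    moreover have "gBA \<cdot> qB \<in> M" "gCA \<cdot> qC \<in> M"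
      using M_comp M g_M B C G by simp_all
    ultimately show ?thesis
      using effective po A unfolding effective_pushouts_def hom_def by blast
  qed
  ultimately show thesis
    using that A' ty by blast
qed

text \<open>Carries the factorisation required of a solution down to a restriction: both sides agree
  after the monomorphism \<open>m\<close>.\<close>

lemma restr_factor:
  assumes a: "restr C j i a' a" and q: "comm_square C j q' q m" and p: "comm_square C i p' p m"
    and m: "m \<in> M" and eq: "q \<cdot> a = p"
  shows "q' \<cdot> a' = p'"
proof (rule mono_cancel[OF M_mono[OF m]])
  note S = restrD[OF a] comm_squareD[OF q] comm_squareD[OF p]
  show "m \<cdot> (q' \<cdot> a') = m \<cdot> p'"
    using S eq by (metis comp_assoc)
qed (use restrD[OF a] comm_squareD[OF q] comm_squareD[OF p] in simp_all)

text \<open>Carries the factorisation up instead. The common domain of \<open>pA\<close> and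
  \<open>aA\<close> is a pushout, so it suffices to compare on \<open>iBA\<close> and
  \<open>iCA\<close>, where the equations for \<open>B\<close> and \<open>C\<close> apply.\<close>

lemma factor_through_gluing:
  assumes T: "typed_square iDB iDC iBA iCA tPA tPB tPC tPD"
    and p: "mor_square iDB iDC iBA iCA pA pB pC pD"
    and q: "mor_square jDB jDC jBA jCA qA qB qC qD"
    and a: "restr C jBA iBA aB aA" "restr C jCA iCA aC aA"
    and eq: "qB \<cdot> aB = pB" "qC \<cdot> aC = pC"
  shows "qA \<cdot> aA = pA"
proof (rule pushout_eqI[OF typed_square_pushout[OF T]])
  have sq: "comm_square C iBA pB pA gBA" "comm_square C iCA pC pA gCA"
    "comm_square C jBA qB qA gBA" "comm_square C jCA qC qA gCA"
    using p q by (auto simp: mor_square_def)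
  note S = sq[THEN comm_squareD(1)] sq[THEN comm_squareD(2)] sq[THEN comm_squareD(3)]
    sq[THEN comm_squareD(4)] sq[THEN comm_squareD(5)] sq[THEN comm_squareD(6)]
    sq[THEN comm_squareD(7)] sq[THEN comm_squareD(8)] sq[THEN comm_squareD(9)]
    restrD[OF a(1)] restrD[OF a(2)]
  show "qA \<cdot> aA \<cdot> iBA = pA \<cdot> iBA"
    using S eq(1) by (metis comp_assoc)
  show "qA \<cdot> aA \<cdot> iCA = pA \<cdot> iCA"
    using S eq(2) by (metis comp_assoc)
qed (use p q restrD[OF a(1)] in \<open>auto simp: mor_square_def comm_square_def\<close>)

section \<open>Traversing the four typed conditions in parallel\<close>

inductive cond_square ::
  "'m \<Rightarrow> 'm \<Rightarrow> 'm \<Rightarrow> 'm \<Rightarrow> ('m, 'i) emb \<Rightarrow> ('m, 'i) emb \<Rightarrow> ('m, 'i) emb \<Rightarrow> ('m, 'i) emb \<Rightarrow>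
   'm \<Rightarrow> ('m, 'i) tcond \<Rightarrow> 'm \<Rightarrow> ('m, 'i) tcond \<Rightarrow> 'm \<Rightarrow> ('m, 'i) tcond \<Rightarrow>
   'm \<Rightarrow> ('m, 'i) tcond \<Rightarrow> bool" where
  square_True: "typed_square iDB iDC iBA iCA tPA tPB tPC tPD \<Longrightarrow>
    cond_square iDB iDC iBA iCA ETrue ETrue ETrue ETrue tPA TTrue tPB TTrue tPC TTrue tPD TTrue"
| square_Ex: "typed_square iDB iDC iBA iCA tPA tPB tPC tPD \<Longrightarrow>
    typed_square jDB jDC jBA jCA xA xB xC xD \<Longrightarrow>
    restr C jDB iDB aD aB \<Longrightarrow> restr C jDC iDC aD aC \<Longrightarrow>
    restr C jBA iBA aB aA \<Longrightarrow> restr C jCA iCA aC aA \<Longrightarrow>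
    cond_square jDB jDC jBA jCA eDB eDC eBA eCA xA acA xB acB xC acC xD acD \<Longrightarrow>
    cond_square iDB iDC iBA iCA (EEx jDB eDB) (EEx jDC eDC) (EEx jBA eBA) (EEx jCA eCA)
      tPA (TEx aA xA acA) tPB (TEx aB xB acB) tPC (TEx aC xC acC) tPD (TEx aD xD acD)"
| square_And: "(\<And>k. k \<in> J \<Longrightarrow> cond_square iDB iDC iBA iCA (eDB k) (eDC k) (eBA k) (eCA k)
      tPA (acA k) tPB (acB k) tPC (acC k) tPD (acD k)) \<Longrightarrow>
    cond_square iDB iDC iBA iCA (EFam J eDB) (EFam J eDC) (EFam J eBA) (EFam J eCA)
      tPA (TAnd J acA) tPB (TAnd J acB) tPC (TAnd J acC) tPD (TAnd J acD)"
| square_Or: "(\<And>k. k \<in> J \<Longrightarrow> cond_square iDB iDC iBA iCA (eDB k) (eDC k) (eBA k) (eCA k)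
      tPA (acA k) tPB (acB k) tPC (acC k) tPD (acD k)) \<Longrightarrow>
    cond_square iDB iDC iBA iCA (EFam J eDB) (EFam J eDC) (EFam J eBA) (EFam J eCA)
      tPA (TOr J acA) tPB (TOr J acB) tPC (TOr J acC) tPD (TOr J acD)"

inductive_cases restr_condE:
  "restr_cond C t i e tP' ac' tP TTrue"
  "restr_cond C t i e tP' ac' tP (TEx a x ac)"
  "restr_cond C t i e tP' ac' tP (TAnd J acs)"
  "restr_cond C t i e tP' ac' tP (TOr J acs)"

inductive_cases emb_commuteE:
  "emb_commute C eDB eDC (EEx jBA eBA) (EEx jCA eCA)"
  "emb_commute C eDB eDC (EFam J eBA) (EFam J eCA)"

lemma restr_cond_top: "restr_cond C t i e tP' ac' tP ac \<Longrightarrow> restr C t i tP' tP"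
  by (erule restr_cond.cases) simp_all

text \<open>Merges the four restrictions into a predicate on which one rule induction descends
  through all conditions at once. The shape of \<open>acA\<close> determines those of
  \<open>acB\<close> and \<open>acC\<close>, and then that of \<open>acD\<close>.\<close>

lemma cond_squareI:
  assumes "restr_cond C tDB iDB eDB tPD acD tPB acB" "restr_cond C tDC iDC eDC tPD acD tPC acC"
    "restr_cond C tBA iBA eBA tPB acB tPA acA" "restr_cond C tCA iCA eCA tPC acC tPA acA"
    "emb_commute C eDB eDC eBA eCA" "iBA \<cdot> iDB = iCA \<cdot> iDC"
  shows "cond_square iDB iDC iBA iCA eDB eDC eBA eCA tPA acA tPB acB tPC acC tPD acD"
  using assms
proof (induction acA arbitrary: iDB iDC iBA iCA eDB eDC eBA eCA tPA tPB acB tPC acC tPD acD)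
  case TTrue
  then have T: "typed_square iDB iDC iBA iCA tPA tPB tPC tPD"
    by (auto simp: typed_square_def dest: restr_cond_top)
  show ?case
    using TTrue by (auto elim!: restr_condE intro: square_True T)
next
  case (TEx aA xA acA)
  then have T: "typed_square iDB iDC iBA iCA tPA tPB tPC tPD"
    by (auto simp: typed_square_def dest: restr_cond_top)
  obtain jBA eBA' aB xB acB' where B: "eBA = EEx jBA eBA'" "acB = TEx aB xB acB'"
      "restr C jBA iBA aB aA" "restr_cond C tBA jBA eBA' xB acB' xA acA"
    using TEx.prems(3) by (auto elim: restr_condE)
  obtain jCA eCA' aC xC acC' where C: "eCA = EEx jCA eCA'" "acC = TEx aC xC acC'"
      "restr C jCA iCA aC aA" "restr_cond C tCA jCA eCA' xC acC' xA acA"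
    using TEx.prems(4) by (auto elim: restr_condE)
  obtain jDB eDB' aD xD acD' where D: "eDB = EEx jDB eDB'" "acD = TEx aD xD acD'"
      "restr C jDB iDB aD aB" "restr_cond C tDB jDB eDB' xD acD' xB acB'"
    using TEx.prems(1) unfolding B by (auto elim: restr_condE)
  obtain jDC eDC' where E: "eDC = EEx jDC eDC'"
      "restr C jDC iDC aD aC" "restr_cond C tDC jDC eDC' xD acD' xC acC'"
    using TEx.prems(2) unfolding C D by (auto elim: restr_condE)
  have c: "jBA \<cdot> jDB = jCA \<cdot> jDC" "emb_commute C eDB' eDC' eBA' eCA'"
    using TEx.prems(5) unfolding B C D E by (auto elim: emb_commuteE)
  \<comment> \<open>The four restrictions one level down form a square because
    \<open>emb_commute\<close> makes their comparison morphisms commute.\<close>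
  have T': "typed_square jDB jDC jBA jCA xA xB xC xD"
    using B C D E c by (auto simp: typed_square_def dest: restr_cond_top)
  show ?case
    unfolding B(1,2) C(1,2) D(1,2) E(1)
    using square_Ex[OF T T' D(3) E(2) B(3) C(3) TEx.IH[OF D(4) E(3) B(4) C(4) c(2,1)]] .
next
  case (TAnd J acA)
  obtain eBA' acB' where B: "eBA = EFam J eBA'" "acB = TAnd J acB'"
      "\<And>k. k \<in> J \<Longrightarrow> restr_cond C tBA iBA (eBA' k) tPB (acB' k) tPA (acA k)"
    using TAnd.prems(3) by (auto elim: restr_condE)
  obtain eCA' acC' where C: "eCA = EFam J eCA'" "acC = TAnd J acC'"
      "\<And>k. k \<in> J \<Longrightarrow> restr_cond C tCA iCA (eCA' k) tPC (acC' k) tPA (acA k)"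
    using TAnd.prems(4) by (auto elim: restr_condE)
  obtain eDB' acD' where D: "eDB = EFam J eDB'" "acD = TAnd J acD'"
      "\<And>k. k \<in> J \<Longrightarrow> restr_cond C tDB iDB (eDB' k) tPD (acD' k) tPB (acB' k)"
    using TAnd.prems(1) unfolding B by (auto elim: restr_condE)
  obtain eDC' where E: "eDC = EFam J eDC'"
      "\<And>k. k \<in> J \<Longrightarrow> restr_cond C tDC iDC (eDC' k) tPD (acD' k) tPC (acC' k)"
    using TAnd.prems(2) unfolding C D by (auto elim: restr_condE)
  have c: "emb_commute C (eDB' k) (eDC' k) (eBA' k) (eCA' k)" if "k \<in> J" for k
    using TAnd.prems(5) that unfolding B C D E by (auto elim: emb_commuteE)
  show ?case
    unfolding B(1,2) C(1,2) D(1,2) E(1)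
    \<comment> \<open>The induction hypothesis speaks of members of the range of the family, hence
      \<open>rangeI\<close>.\<close>
    by (rule square_And, rule TAnd.IH[OF rangeI]) (use B C D E c TAnd.prems(6) in auto)
next
  case (TOr J acA)
  obtain eBA' acB' where B: "eBA = EFam J eBA'" "acB = TOr J acB'"
      "\<And>k. k \<in> J \<Longrightarrow> restr_cond C tBA iBA (eBA' k) tPB (acB' k) tPA (acA k)"
    using TOr.prems(3) by (auto elim: restr_condE)
  obtain eCA' acC' where C: "eCA = EFam J eCA'" "acC = TOr J acC'"
      "\<And>k. k \<in> J \<Longrightarrow> restr_cond C tCA iCA (eCA' k) tPC (acC' k) tPA (acA k)"
    using TOr.prems(4) by (auto elim: restr_condE)
  obtain eDB' acD' where D: "eDB = EFam J eDB'" "acD = TOr J acD'"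
      "\<And>k. k \<in> J \<Longrightarrow> restr_cond C tDB iDB (eDB' k) tPD (acD' k) tPB (acB' k)"
    using TOr.prems(1) unfolding B by (auto elim: restr_condE)
  obtain eDC' where E: "eDC = EFam J eDC'"
      "\<And>k. k \<in> J \<Longrightarrow> restr_cond C tDC iDC (eDC' k) tPD (acD' k) tPC (acC' k)"
    using TOr.prems(2) unfolding C D by (auto elim: restr_condE)
  have c: "emb_commute C (eDB' k) (eDC' k) (eBA' k) (eCA' k)" if "k \<in> J" for k
    using TOr.prems(5) that unfolding B C D E by (auto elim: emb_commuteE)
  show ?case
    unfolding B(1,2) C(1,2) D(1,2) E(1)
    by (rule square_Or, rule TOr.IH[OF rangeI]) (use B C D E c TOr.prems(6) in auto)
qed

section \<open>Decomposition and composition of solutions\<close>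

inductive_cases solutionE:
  "solution C M p PTrue Q"
  "solution C M p (PEx a ac) Q"
  "solution C M p (PAnd J acs) Q"
  "solution C M p (POr J acs) Q"

inductive_cases sol_typedE:
  "sol_typed C g (TEx a x ac) (SEx q Q)"
  "sol_typed C g (TAnd J acs) (SFam J Q)"
  "sol_typed C g (TOr J acs) (SFam J Q)"

inductive_cases restr_solE:
  "restr_sol C i e Q' SEmpty"
  "restr_sol C i e SEmpty Q"
  "restr_sol C i (EEx j e) (SEx q' Q') (SEx q Q)"
  "restr_sol C i (EFam J e) (SFam J Q') (SFam J Q)"

text \<open>\<open>SEmpty\<close> is both the solution for \<open>PTrue\<close> and the filler for
  unchosen disjuncts. This separates the two uses when a chosen disjunct has an empty
  solution.\<close>

lemma solution_SEmpty: "solution C M p ac SEmpty \<Longrightarrow> ac = PTrue"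
  by (erule solution.cases) simp_all

text \<open>Stated for arbitrary commuting \<open>pA\<close>, \<open>pB\<close>, \<open>pC\<close>,
  \<open>pD\<close> instead of initial morphisms: below an existential quantifier their place is
  taken by the solution morphisms of that level.\<close>

theorem decomposition:
  assumes "cond_square iDB iDC iBA iCA eDB eDC eBA eCA tPA acA tPB acB tPC acC tPD acD"
    and "mor_square iDB iDC iBA iCA pA pB pC pD"
    and "solution C M pA (untyped acA) QA" "sol_typed C gA acA QA"
  shows "\<exists>QB QC QD. solution C M pB (untyped acB) QB \<and> sol_typed C gB acB QB \<and>
      solution C M pC (untyped acC) QC \<and> sol_typed C gC acC QC \<and>
      solution C M pD (untyped acD) QD \<and> sol_typed C gD acD QD \<and>
      restr_sol C gDB eDB QD QB \<and> restr_sol C gDC eDC QD QC \<and>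
      restr_sol C gBA eBA QB QA \<and> restr_sol C gCA eCA QC QA"
    (is "\<exists>QB QC QD. ?decomp pB pC pD eDB eDC eBA eCA acB acC acD QA QB QC QD")
  using assms
proof (induction arbitrary: pA pB pC pD QA rule: cond_square.induct)
  case (square_True iDB iDC iBA iCA tPA tPB tPC tPD)
  then have "QA = SEmpty" "pB \<in> Mor C" "pC \<in> Mor C" "pD \<in> Mor C"
    by (auto simp: mor_square_def comm_square_def elim: solutionE)
  then show ?case
    by (auto intro!: exI[of _ SEmpty] solution.intros sol_typed.intros restr_sol.intros)
next
  case (square_Ex iDB iDC iBA iCA tPA tPB tPC tPD jDB jDC jBA jCA xA xB xC xD
      aD aB aC aA eDB eDC eBA eCA acA acB acC acD)
  obtain qA QA' where A: "QA = SEx qA QA'" "qA \<in> hom C (Cod C aA) (Cod C pA)" "qA \<in> M"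
      "qA \<cdot> aA = pA" "solution C M qA (untyped acA) QA'"
    using square_Ex.prems(2) by (simp, elim solutionE, blast)
  have ty: "gA \<cdot> qA = xA" "sol_typed C gA acA QA'"
    using square_Ex.prems(3) unfolding A by (auto elim: sol_typedE)
  have p: "comm_square C iDB pD pB gDB" "comm_square C iDC pD pC gDC"
     "comm_square C iBA pB pA gBA" "comm_square C iCA pC pA gCA"
    using square_Ex.prems(1) by (auto simp: mor_square_def)
  have "restr C tBA jBA xB xA"
    using square_Ex.hyps by (simp add: typed_square_def)
  then have "qA \<in> Mor C" "Dom C qA = Dom C xA" "Cod C qA = Dom C gA"
    using A(2) restrD[OF \<open>restr C jBA iBA aB aA\<close>] comm_squareD[OF p(3)] restrD[OF g_restr(3)]
    by (auto simp: hom_def dest: restrD)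
  then obtain qB qC qD where r: "restr C gDB jDB qD qB" "restr C gDC jDC qD qC"
    "restr C gBA jBA qB qA" "restr C gCA jCA qC qA"
    and t: "gB \<cdot> qB = xB" "gC \<cdot> qC = xC" "gD \<cdot> qD = xD"
    using decompose_mor[OF square_Ex.hyps(2) _ _ _ ty(1)] by blast
  note r' = r[unfolded restr_def, THEN pullback_comm]
  have M: "qB \<in> M" "qC \<in> M" "qD \<in> M"
    using r A(3) restr_M by blast+
  \<comment> \<open>The factorisation passes from \<open>A\<close> to \<open>B\<close> and
    \<open>C\<close>, and from \<open>B\<close> on to \<open>D\<close>.\<close>
  have fB: "qB \<cdot> aB = pB"
    using restr_factor[OF square_Ex.hyps(5) r'(3) p(3) g_M(3) A(4)] .
  have fC: "qC \<cdot> aC = pC"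
    using restr_factor[OF square_Ex.hyps(6) r'(4) p(4) g_M(4) A(4)] .
  have fD: "qD \<cdot> aD = pD"
    using restr_factor[OF square_Ex.hyps(3) r'(1) p(1) g_M(1) fB] .
  have h: "qB \<in> hom C (Cod C aB) (Cod C pB)" "qC \<in> hom C (Cod C aC) (Cod C pC)"
    "qD \<in> hom C (Cod C aD) (Cod C pD)"
    using restrD[OF r(1)] restrD[OF r(3)] restrD[OF r(4)] comm_squareD[OF p(1)]
      comm_squareD[OF p(3)] comm_squareD[OF p(4)] restrD[OF square_Ex.hyps(3)]
      restrD[OF square_Ex.hyps(5)] restrD[OF square_Ex.hyps(6)]
    by (auto simp: hom_def)
  obtain QB QC QD where Q: "?decomp qB qC qD eDB eDC eBA eCA acB acC acD QA' QB QC QD"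
    using square_Ex.IH[OF restr_mor_square[OF r] A(5) ty(2)] by blast
  show ?case
    unfolding A(1) using Q M h r t fB fC fD
    by (intro exI[of _ "SEx qB QB"] exI[of _ "SEx qC QC"] exI[of _ "SEx qD QD"])
      (auto intro!: solution.intros sol_typed.intros restr_sol.intros)
next
  case (square_And J iDB iDC iBA iCA eDB eDC eBA eCA tPA acA tPB acB tPC acC tPD acD)
  obtain Q where Q: "QA = SFam J Q" "\<And>k. k \<in> J \<Longrightarrow> solution C M pA (untyped (acA k)) (Q k)"
    using square_And.prems(2) by (simp, elim solutionE, blast)
  have ty: "sol_typed C gA (acA k) (Q k)" if "k \<in> J" for k
    using square_And.prems(3) that unfolding Q by (auto elim: sol_typedE)
  \<comment> \<open>The membership test stands inside the existential quantifiers so that choice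
    yields families defined on all indices.\<close>
  have "\<forall>k. \<exists>QB QC QD. k \<in> J \<longrightarrow> ?decomp pB pC pD (eDB k) (eDC k) (eBA k) (eCA k)
      (acB k) (acC k) (acD k) (Q k) QB QC QD"
    using square_And.IH[OF _ square_And.prems(1) Q(2) ty] by blast
  then obtain QB QC QD where "\<And>k. k \<in> J \<Longrightarrow> ?decomp pB pC pD (eDB k) (eDC k) (eBA k) (eCA k)
      (acB k) (acC k) (acD k) (Q k) (QB k) (QC k) (QD k)"
    by metis
  then show ?case
    unfolding Q(1)
    by (intro exI[of _ "SFam J QB"] exI[of _ "SFam J QC"] exI[of _ "SFam J QD"])
      (auto intro!: solution.intros sol_typed.intros restr_sol.intros)
next
  case (square_Or J iDB iDC iBA iCA eDB eDC eBA eCA tPA acA tPB acB tPC acC tPD acD)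
  obtain Q j where Q: "QA = SFam J Q" "j \<in> J" "solution C M pA (untyped (acA j)) (Q j)"
      "\<And>k. k \<in> J \<Longrightarrow> k \<noteq> j \<Longrightarrow> Q k = SEmpty"
    using square_Or.prems(2) by (simp, elim solutionE, blast)
  have ty: "sol_typed C gA (acA j) (Q j)"
    using square_Or.prems(3) Q(2) unfolding Q(1) by (auto elim: sol_typedE)
  obtain QB QC QD where D: "?decomp pB pC pD (eDB j) (eDC j) (eBA j) (eCA j)
      (acB j) (acC j) (acD j) (Q j) QB QC QD"
    using square_Or.IH[OF Q(2) square_Or.prems(1) Q(3) ty] by blast
  \<comment> \<open>All four solutions choose the disjunct \<open>j\<close>; elsewhere
    \<open>SEmpty\<close> is a restriction of \<open>SEmpty\<close>.\<close>
  let ?ext = "\<lambda>q k. if k = j then q else SEmpty"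
  have "solution C M p (POr J acs) (SFam J (?ext q))" if "solution C M p (acs j) q" for p acs q
    using that Q(2) by (intro solution.intros(4)[of j]) auto
  moreover have "sol_typed C g (TOr J acs) (SFam J (?ext q))" if "sol_typed C g (acs j) q" for g acs q
    using that by (intro sol_typed.intros) (auto intro: sol_typed.intros)
  moreover have "restr_sol C i (EFam J e) (SFam J (?ext q')) (SFam J (?ext q))"
    if "restr_sol C i (e j) q' q" for i e q q'
    using that by (intro restr_sol.intros) (auto intro: restr_sol.intros)
  moreover have "restr_sol C i (EFam J e) (SFam J (?ext q')) (SFam J Q)"
    if "restr_sol C i (e j) q' (Q j)" for i e q'
    using that Q(4) by (intro restr_sol.intros) (auto intro: restr_sol.intros)
  ultimately show ?case
    unfolding Q(1) using D
    by (intro exI[of _ "SFam J (?ext QB)"] exI[of _ "SFam J (?ext QC)"]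
        exI[of _ "SFam J (?ext QD)"]) simp
qed

text \<open>\<open>QD\<close> aligns the two given solutions: at an existential quantifier it
  supplies the common restriction that \<open>compose_mor\<close> glues along, and at a disjunction
  it links the choices made in \<open>QB\<close> and \<open>QC\<close>.\<close>

theorem composition:
  assumes "cond_square iDB iDC iBA iCA eDB eDC eBA eCA tPA acA tPB acB tPC acC tPD acD"
    and "mor_square iDB iDC iBA iCA pA pB pC pD"
    and "solution C M pB (untyped acB) QB" "sol_typed C gB acB QB"
    and "solution C M pC (untyped acC) QC" "sol_typed C gC acC QC"
    and "solution C M pD (untyped acD) QD"
    and "restr_sol C gDB eDB QD QB" "restr_sol C gDC eDC QD QC"
  shows "\<exists>QA. solution C M pA (untyped acA) QA \<and> sol_typed C gA acA QA \<and>
      restr_sol C gBA eBA QB QA \<and> restr_sol C gCA eCA QC QA"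
    (is "\<exists>QA. ?comp pA eBA eCA acA QB QC QA")
  using assms
proof (induction arbitrary: pA pB pC pD QB QC QD rule: cond_square.induct)
  case (square_True iDB iDC iBA iCA tPA tPB tPC tPD)
  then have "QB = SEmpty" "QC = SEmpty" "pA \<in> Mor C"
    by (auto simp: mor_square_def comm_square_def elim: solutionE)
  then show ?case
    by (auto intro!: exI[of _ SEmpty] solution.intros sol_typed.intros restr_sol.intros)
next
  case (square_Ex iDB iDC iBA iCA tPA tPB tPC tPD jDB jDC jBA jCA xA xB xC xD
      aD aB aC aA eDB eDC eBA eCA acA acB acC acD)
  obtain qB QB' where B: "QB = SEx qB QB'" "qB \<in> M" "qB \<cdot> aB = pB" "solution C M qB (untyped acB) QB'"
    using square_Ex.prems(2) by (simp, elim solutionE, blast)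
  obtain qC QC' where C: "QC = SEx qC QC'" "qC \<in> M" "qC \<cdot> aC = pC" "solution C M qC (untyped acC) QC'"
    using square_Ex.prems(4) by (simp, elim solutionE, blast)
  obtain qD QD' where D: "QD = SEx qD QD'" "solution C M qD (untyped acD) QD'"
    using square_Ex.prems(6) by (simp, elim solutionE, blast)
  have ty: "gB \<cdot> qB = xB" "sol_typed C gB acB QB'" "gC \<cdot> qC = xC" "sol_typed C gC acC QC'"
    using square_Ex.prems(3,5) unfolding B C by (auto elim: sol_typedE)
  have r: "restr C gDB jDB qD qB" "restr_sol C gDB eDB QD' QB'"
    "restr C gDC jDC qD qC" "restr_sol C gDC eDC QD' QC'"
    using square_Ex.prems(7,8) unfolding B C D by (auto elim: restr_solE)
  obtain qA where A: "qA \<in> M" "Dom C qA = Dom C xA" "Cod C qA = Dom C gA" "gA \<cdot> qA = xA"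
    "restr C gBA jBA qB qA" "restr C gCA jCA qC qA"
    using compose_mor[OF square_Ex.hyps(2) r(1,3) B(2) C(2) ty(1,3)] .
  have q: "mor_square jDB jDC jBA jCA qA qB qC qD"
    using restr_mor_square[OF r(1,3) A(5,6)] .
  have f: "qA \<cdot> aA = pA"
    using factor_through_gluing[OF square_Ex.hyps(1) square_Ex.prems(1) q square_Ex.hyps(5,6)
        B(3) C(3)] .
  have "comm_square C iBA pB pA gBA"
    using square_Ex.prems(1) by (simp add: mor_square_def)
  then have h: "qA \<in> hom C (Cod C aA) (Cod C pA)"
    using M_Mor[OF A(1)] restrD[OF A(5)] restrD[OF square_Ex.hyps(5)]
    by (auto simp: hom_def comm_square_def)
  obtain QA where "?comp qA eBA eCA acA QB' QC' QA"
    using square_Ex.IH[OF q B(4) ty(2) C(4) ty(4) D(2) r(2,4)] by blast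
  then show ?case
    unfolding B(1) C(1) using A h f
    by (intro exI[of _ "SEx qA QA"])
      (auto intro!: solution.intros sol_typed.intros restr_sol.intros)
next
  case (square_And J iDB iDC iBA iCA eDB eDC eBA eCA tPA acA tPB acB tPC acC tPD acD)
  obtain QB' where B: "QB = SFam J QB'" "\<And>k. k \<in> J \<Longrightarrow> solution C M pB (untyped (acB k)) (QB' k)"
    using square_And.prems(2) by (simp, elim solutionE, blast)
  obtain QC' where C: "QC = SFam J QC'" "\<And>k. k \<in> J \<Longrightarrow> solution C M pC (untyped (acC k)) (QC' k)"
    using square_And.prems(4) by (simp, elim solutionE, blast)
  obtain QD' where D: "QD = SFam J QD'" "\<And>k. k \<in> J \<Longrightarrow> solution C M pD (untyped (acD k)) (QD' k)"
    using square_And.prems(6) by (simp, elim solutionE, blast)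
  have ty: "sol_typed C gB (acB k) (QB' k)" "sol_typed C gC (acC k) (QC' k)"
    "restr_sol C gDB (eDB k) (QD' k) (QB' k)" "restr_sol C gDC (eDC k) (QD' k) (QC' k)"
    if "k \<in> J" for k
    using square_And.prems(3,5,7,8) that unfolding B C D by (auto elim: sol_typedE restr_solE)
  have "\<exists>QA. ?comp pA (eBA k) (eCA k) (acA k) (QB' k) (QC' k) QA" if "k \<in> J" for k
    using square_And.IH[OF that square_And.prems(1)] B(2) C(2) D(2) ty that by blast
  then obtain QA where "\<And>k. k \<in> J \<Longrightarrow> ?comp pA (eBA k) (eCA k) (acA k) (QB' k) (QC' k) (QA k)"
    by metis
  then show ?case
    unfolding B(1) C(1)
    by (intro exI[of _ "SFam J QA"])
      (auto intro!: solution.intros sol_typed.intros restr_sol.intros)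
next
  case (square_Or J iDB iDC iBA iCA eDB eDC eBA eCA tPA acA tPB acB tPC acC tPD acD)
  obtain QB' j where B: "QB = SFam J QB'" "j \<in> J" "solution C M pB (untyped (acB j)) (QB' j)"
      "\<And>k. k \<in> J \<Longrightarrow> k \<noteq> j \<Longrightarrow> QB' k = SEmpty"
    using square_Or.prems(2) by (simp, elim solutionE, blast)
  obtain QC' l where C: "QC = SFam J QC'" "l \<in> J" "solution C M pC (untyped (acC l)) (QC' l)"
      "\<And>k. k \<in> J \<Longrightarrow> k \<noteq> l \<Longrightarrow> QC' k = SEmpty"
    using square_Or.prems(4) by (simp, elim solutionE, blast)
  obtain QD' m where D: "QD = SFam J QD'" "m \<in> J" "solution C M pD (untyped (acD m)) (QD' m)"
      "\<And>k. k \<in> J \<Longrightarrow> k \<noteq> m \<Longrightarrow> QD' k = SEmpty"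
    using square_Or.prems(6) by (simp, elim solutionE, blast)
  have ty: "sol_typed C gB (acB k) (QB' k)" "sol_typed C gC (acC k) (QC' k)"
    "restr_sol C gDB (eDB k) (QD' k) (QB' k)" "restr_sol C gDC (eDC k) (QD' k) (QC' k)"
    if "k \<in> J" for k
    using square_Or.prems(3,5,7,8) that unfolding B(1) C(1) D(1) by (auto elim: sol_typedE restr_solE)
  \<comment> \<open>\<open>restr_sol\<close> relates \<open>SEmpty\<close> only to
    \<open>SEmpty\<close>, so emptiness passes between \<open>QB'\<close> and \<open>QC'\<close>
    through \<open>QD'\<close>.\<close>
  have empty: "QB' k = SEmpty \<longleftrightarrow> QD' k = SEmpty" "QC' k = SEmpty \<longleftrightarrow> QD' k = SEmpty"
    if "k \<in> J" for k
    using ty(3,4)[OF that] by (auto elim: restr_solE)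
  txt \<open>The three disjuncts \<open>j\<close>, \<open>l\<close>, \<open>m\<close> may differ only if all solutions of disjuncts are
    empty, and then the chosen disjuncts are \<open>true\<close>.\<close>
  have "solution C M pC (untyped (acC j)) (QC' j) \<and> solution C M pD (untyped (acD j)) (QD' j)"
  proof (cases "QB' j = SEmpty")
    case True
    then have "untyped (acB j) = PTrue" "QC' j = SEmpty" "QD' j = SEmpty"
      using solution_SEmpty B(2,3) empty by metis+
    \<comment> \<open>The conditions in a \<open>cond_square\<close> have the same outermost
      constructor, so \<open>true\<close> at \<open>B\<close> forces \<open>true\<close> at
      \<open>C\<close> and \<open>D\<close>.\<close>
    moreover from this have "untyped (acC j) = PTrue" "untyped (acD j) = PTrue"
      using square_Or.hyps[OF B(2)] by (auto elim: cond_square.cases)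
    moreover have "pC \<in> Mor C" "pD \<in> Mor C"
      using square_Or.prems(1) by (auto simp: mor_square_def comm_square_def)
    ultimately show ?thesis
      by (auto intro: solution.intros)
  next
    case False
    \<comment> \<open>A nonempty component at \<open>j\<close> in \<open>QB'\<close> is nonempty in
      \<open>QC'\<close> and \<open>QD'\<close> too, and only a chosen disjunct can have
      one.\<close>
    then have "j = l" "j = m"
      using empty B(2) C(4) D(4) by metis+
    then show ?thesis
      using C(3) D(3) by simp
  qed
  then obtain Q where Q: "?comp pA (eBA j) (eCA j) (acA j) (QB' j) (QC' j) Q"
    using square_Or.IH[OF B(2) square_Or.prems(1) B(3)] ty B(2) by blast
  let ?Q = "\<lambda>k. if k = j then Q else SEmpty"
  \<comment> \<open>In the empty case \<open>l\<close> may differ from \<open>j\<close>, so the fact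
    is transferred from \<open>QB'\<close> instead of read off the choice of
    \<open>l\<close>.\<close>
  have "QC' k = SEmpty" if "k \<in> J" "k \<noteq> j" for k
    using B(4) empty that by blast
  then have "?comp pA (EFam J eBA) (EFam J eCA) (TOr J acA) (SFam J QB') (SFam J QC') (SFam J ?Q)"
    using Q B(2,4)
    by (auto intro!: solution.intros(4)[of j] sol_typed.intros(4) restr_sol.intros(3)
        intro: sol_typed.intros restr_sol.intros)
  then show ?case
    unfolding B(1) C(1) by blast
qed

end

section \<open>Specialisation to initial satisfaction\<close>

theorem theorem5p1:
  fixes C :: "('o, 'm, 'z) cat_scheme" and M :: "'m set" and I :: 'o
    and TGA TGB TGC TGD GA GB GC GD :: 'o
    and tgDB tgDC tgBA tgCA gA gB gC gD :: 'm
    and gDB gDC gBA gCA :: 'm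
    and acA acB acC acD :: "('m, 'i) tcond"
    and i :: "'m sides" and e :: "('m, 'i) emb sides"
  assumes "M_adhesive C M" and "initial C I"
    and "horizontal_VK C M" and "effective_pushouts C M"
    and "tgDB \<in> hom C TGD TGB" and "tgDC \<in> hom C TGD TGC"
    and "tgBA \<in> hom C TGB TGA" and "tgCA \<in> hom C TGC TGA"
    and "{tgDB, tgDC, tgBA, tgCA} \<subseteq> M" and "pushout C tgDB tgDC tgBA tgCA"
    and "gA \<in> hom C GA TGA" and "gB \<in> hom C GB TGB"
    and "gC \<in> hom C GC TGC" and "gD \<in> hom C GD TGD"
    and "amalg_obj C (tgDB, tgDC, tgBA, tgCA) (gDB, gDC, gBA, gCA) gA gB gD gC"
    and "typed_cond C TGA I (initial_mor C I TGA) acA"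
    and "typed_cond C TGB I (initial_mor C I TGB) acB"
    and "typed_cond C TGC I (initial_mor C I TGC) acC"
    and "typed_cond C TGD I (initial_mor C I TGD) acD"
    and "amalg_cond C (tgDB, tgDC, tgBA, tgCA) i e
           (initial_mor C I TGA) acA (initial_mor C I TGB) acB
           (initial_mor C I TGD) acD (initial_mor C I TGC) acC"
  shows "(\<forall>QA. init_solution C M I gA acA QA \<longrightarrow>
            (\<exists>QB QC QD. init_solution C M I gB acB QB \<and> init_solution C M I gC acC QC \<and>
               init_solution C M I gD acD QD \<and>
               amalg_sol C (gDB, gDC, gBA, gCA) e QA QB QD QC)) \<and>
         (\<forall>QB QC QD. init_solution C M I gB acB QB \<and> init_solution C M I gC acC QC \<and>
            init_solution C M I gD acD QD \<and> agree_sol C (gDB, gDC, gBA, gCA) e QB QD QC \<longrightarrow>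
            (\<exists>QA. init_solution C M I gA acA QA \<and>
               amalg_sol C (gDB, gDC, gBA, gCA) e QA QB QD QC))"
proof -
  interpret M_adhesive C M
    by fact
  interpret typed_amalgamation C M tgDB tgDC tgBA tgCA gDB gDC gBA gCA gA gB gC gD
    by unfold_locales (use assms in \<open>simp_all\<close>)
  obtain iDB iDC iBA iCA where i: "i = (iDB, iDC, iBA, iCA)"
    by (cases i) auto
  obtain eDB eDC eBA eCA where e: "e = (eDB, eDC, eBA, eCA)"
    by (cases e) auto
  let ?p = "initial_mor C I"
  have uniq: "f = f'" if "f \<in> hom C I X" "f' \<in> hom C I X" for f f' X
  proof -
    have "X \<in> Obj C"
      using that Cod_in by (auto simp: hom_def)
    then show ?thesis
      using assms(2) that by (auto simp: initial_def)
  qed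
  have init: "?p X \<in> hom C I X" if "X \<in> Obj C" for X
    using that assms(2) unfolding initial_def initial_mor_def by (metis theI')
  have tops: "?p TGA \<in> hom C I TGA" "?p TGB \<in> hom C I TGB"
    "?p TGC \<in> hom C I TGC" "?p TGD \<in> hom C I TGD"
    using assms(16-19) by (auto simp: typed_cond_def)
  have am: "restr_cond C tgDB iDB eDB (?p TGD) acD (?p TGB) acB"
    "restr_cond C tgDC iDC eDC (?p TGD) acD (?p TGC) acC"
    "restr_cond C tgBA iBA eBA (?p TGB) acB (?p TGA) acA"
    "restr_cond C tgCA iCA eCA (?p TGC) acC (?p TGA) acA"
    "emb_commute C eDB eDC eBA eCA" "pushout C iDB iDC iBA iCA"
    using assms(20) unfolding i e by auto
  have square: "cond_square iDB iDC iBA iCA eDB eDC eBA eCA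
      (?p TGA) acA (?p TGB) acB (?p TGC) acC (?p TGD) acD"
    using cond_squareI[OF am(1-5) pushoutD(9)[OF am(6)]] .
  \<comment> \<open>All four constraints have \<open>I\<close> as top object, so the top comparison
    morphisms are endomorphisms of \<open>I\<close>.\<close>
  have ihom: "iDB \<in> hom C I I" "iDC \<in> hom C I I" "iBA \<in> hom C I I" "iCA \<in> hom C I I"
    using restrD[OF restr_cond_top[OF am(1)]] restrD[OF restr_cond_top[OF am(2)]]
      restrD[OF restr_cond_top[OF am(3)]] restrD[OF restr_cond_top[OF am(4)]] tops
    by (auto simp: hom_def)
  have dom: "Dom C gA = GA" "Dom C gB = GB" "Dom C gC = GC" "Dom C gD = GD"
    using assms(11-14) by (auto simp: hom_def)
  have ghom: "gDB \<in> hom C GD GB" "gDC \<in> hom C GD GC" "gBA \<in> hom C GB GA" "gCA \<in> hom C GC GA"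
    using g_restr[THEN restrD(1)] g_restr[THEN restrD(5)] g_restr[THEN restrD(6)] dom
    by (auto simp: hom_def)
  \<comment> \<open>Both composites are morphisms from \<open>I\<close> to \<open>G\<close>, hence
    equal by initiality.\<close>
  have p_square: "comm_square C j (?p G') (?p G) g"
    if j: "j \<in> hom C I I" and g: "g \<in> hom C G' G" for j g G G'
  proof -
    have "G' \<in> Obj C" "G \<in> Obj C"
      using g Dom_in Cod_in by (auto simp: hom_def)
    note P = init[OF this(1)] init[OF this(2)]
    have "?p G \<cdot>\<^bsub>C\<^esub> j = g \<cdot>\<^bsub>C\<^esub> ?p G'"
      using uniq comp_in[OF j P(2)] comp_in[OF P(1) g] by blast
    then show ?thesis
      using P j g by (auto simp: comm_square_def hom_def)
  qed
  have ms: "mor_square iDB iDC iBA iCA (?p GA) (?p GB) (?p GC) (?p GD)"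
    unfolding mor_square_def using p_square ihom ghom by blast
  show ?thesis
    unfolding init_solution_def dom e amalg_sol.simps agree_sol.simps
    using decomposition[OF square ms] composition[OF square ms] by blast
qed

end
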